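(* Let $T$ be a connected simple graph satisfying property $\mathcal{P}$, and let $m$ be an integer with $2 \leq m < \chi(T)$. Then $$\chi(K_m^T) = \mathrm{conn}(\mathcal{N}(K_m^T)) + 3.$$ Moreover, $\mathcal{N}(K_m^T)$ is homotopy equivalent to the sphere $\mathbb{S}^{m-2}$.
   Context: All graphs are finite, undirected, without multiple edges; loops are allowed unless the graph is called simple (no loops). $E(G)\subseteq V(G)\times V(G)$ is the symmetric edge relation, and $x \sim y$ means $(x,y)\in E(G)$. $K_n$ is the complete graph with $V(K_n)=\{1,\dots,n\}$ and $E(K_n)=\{(i,j) : i\neq j\}$. A graph homomorphism is a vertex map preserving edges. The chromatic number $\chi(G)$ of a simple graph $G$ is the least $n$ such that there is a graph homomorphism $G\to K_n$. Property $\mathcal{P}$: a simple graph $G$ satisfies $\mathcal{P}$ if for any two edges $(v_1,w_1)$ and $(v_2,w_2)$ of $G$ with $\{v_1,w_1\}\cap\{v_2,w_2\}=\emptyset$, if $(v_2,v_1)\in E(G)$ then $(w_2,v_1)\in E(G)$ or $(w_2,w_1)\in E(G)$. Exponential graph: $H^G$ has as vertices all set maps $V(G)\to V(H)$, and $f\sim f'$ in $H^G$ iff $v\sim v'$ in $G$ implies $f(v)\sim f'(v')$ in $H$. Neighborhood complex: for $A\subseteq V(G)$ let $N_G(A)=\{x\in V(G) : (x,a)\in E(G)\ \forall a\in A\}$. $\mathcal{N}(G)$ is the simplicial complex with simplices the $A\subseteq V(G)$ with $N_G(A)\neq\emptyset$, regarded as a topological space via its geometric realization. A space $X$ is $k$-connected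 if for all $0\le j\le k$ every continuous map $\mathbb{S}^j\to X$ extends to the ball $\mathbb{B}^{j+1}$; $\mathrm{conn}(X)$ is the largest $k$ such that $X$ is $k$-connected, and it is $-1$ for a nonempty disconnected space. *)

theory Defs
  imports
    "HOL-Analysis.Analysis"
    "Graph_Theory.Pair_Digraph"
    "Graph_Theory.Digraph_Component"
begin

(* Graphs are pair digraphs, i.e. a vertex set with an edge relation contained in V x V.
   A finite undirected graph, possibly with loops, is a pair_pseudo_graph; a finite simple
   graph is a pair_graph. *)

definition graph_hom :: "'a pair_pre_digraph \<Rightarrow> 'b pair_pre_digraph \<Rightarrow> ('a \<Rightarrow> 'b) \<Rightarrow> bool" where
  "graph_hom G H f \<longleftrightarrow>
     f \<in> pverts G \<rightarrow> pverts H \<and> (\<forall>x y. (x, y) \<in> parcs G \<longrightarrow> (f x, f y) \<in> parcs H)"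

definition complete_graph :: "nat \<Rightarrow> nat pair_pre_digraph" where
  "complete_graph n =
     \<lparr>pverts = {1..n}, parcs = {(i, j). i \<in> {1..n} \<and> j \<in> {1..n} \<and> i \<noteq> j}\<rparr>"

(* Only meaningful for finite graphs without loops: otherwise there is no such n. *)
definition chromatic_number :: "'a pair_pre_digraph \<Rightarrow> nat" where
  "chromatic_number G = (LEAST n. \<exists>f. graph_hom G (complete_graph n) f)"

definition property_P :: "'a pair_pre_digraph \<Rightarrow> bool" where
  "property_P G \<longleftrightarrow>
     (\<forall>v1 w1 v2 w2. (v1, w1) \<in> parcs G \<longrightarrow> (v2, w2) \<in> parcs G \<longrightarrow> {v1, w1} \<inter> {v2, w2} = {} \<longrightarrow>
        (v2, v1) \<in> parcs G \<longrightarrow> (w2, v1) \<in> parcs G \<or> (w2, w1) \<in> parcs G)"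

(* exp_graph H G is the graph H^G. A set map V(G) -> V(H) is represented by the unique
   function that extends it by undefined outside V(G), so that distinct vertices are
   distinct maps. *)
definition exp_graph :: "'b pair_pre_digraph \<Rightarrow> 'a pair_pre_digraph \<Rightarrow> ('a \<Rightarrow> 'b) pair_pre_digraph" where
  "exp_graph H G =
     \<lparr>pverts = pverts G \<rightarrow>\<^sub>E pverts H,
      parcs = {(f, f'). f \<in> pverts G \<rightarrow>\<^sub>E pverts H \<and> f' \<in> pverts G \<rightarrow>\<^sub>E pverts H \<and>
                 (\<forall>v v'. (v, v') \<in> parcs G \<longrightarrow> (f v, f' v') \<in> parcs H)}\<rparr>"

definition common_neighbors :: "'a pair_pre_digraph \<Rightarrow> 'a set \<Rightarrow> 'a set" where
  "common_neighbors G A = {x \<in> pverts G. \<forall>a\<in>A. (x, a) \<in> parcs G}"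

definition neighborhood_complex :: "'a pair_pre_digraph \<Rightarrow> 'a set set" where
  "neighborhood_complex G = {A. A \<subseteq> pverts G \<and> common_neighbors G A \<noteq> {}}"

(* The points are the barycentric coordinates, extended by 0 off the vertex set. The
   subspace topology of the product topology is the topology of the realization for
   finite complexes, which is the only case used here. The empty simplex, which the
   neighborhood complex may contain, contributes no point. *)
definition geometric_realization :: "'a set set \<Rightarrow> ('a \<Rightarrow> real) topology" where
  "geometric_realization S =
     subtopology (powertop_real UNIV)
       {t. (\<forall>v. 0 \<le> t v) \<and> {v. t v \<noteq> 0} \<in> S \<and> (\<Sum>v | t v \<noteq> 0. t v) = 1}"

definition nball :: "nat \<Rightarrow> (nat \<Rightarrow> real) topology" where
  "nball n = subtopology (Euclidean_space n) {x. (\<Sum>i<n. (x i)\<^sup>2) \<le> 1}"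

definition k_connected :: "int \<Rightarrow> 'a topology \<Rightarrow> bool" where
  "k_connected k X \<longleftrightarrow>
     (\<forall>j::nat. int j \<le> k \<longrightarrow>
        (\<forall>f. continuous_map (nsphere j) X f \<longrightarrow>
           (\<exists>g. continuous_map (nball (Suc j)) X g \<and> (\<forall>x\<in>topspace (nsphere j). g x = f x))))"

(* The largest k such that X is k-connected, and infinity if there is no largest one.
   Every space is k-connected for every negative k, so the value is at least -1, and it
   is -1 for a nonempty space that is not path-connected. *)
definition conn :: "'a topology \<Rightarrow> ereal" where
  "conn X = (SUP k\<in>{k. k_connected k X}. ereal (real_of_int k))"

end

theory Submission
  imports Defs "HOL-Homology.Brouwer_Degree"
begin

text \<open>
  Write \<open>E\<close> for the exponential graph, whose vertices are the maps from \<open>T\<close> to \<open>{1..m}\<close>. In a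
  connected graph with property \<open>\<P>\<close> every edge \<open>{a, b}\<close> is totally dominating: each vertex is
  adjacent to \<open>a\<close> or to \<open>b\<close> (\<open>edge_dominates\<close>). Since \<open>m < \<chi>(T)\<close>, every vertex \<open>f\<close> of \<open>E\<close> is
  constant on some edge; let \<open>i\<close> be its colour there. A neighbour \<open>g\<close> of \<open>f\<close> satisfies
  \<open>g v \<noteq> f a\<close> or \<open>g v \<noteq> f b\<close> for each \<open>v\<close>, and so never takes the value \<open>i\<close>. This means that every
  neighbour of \<open>f\<close> is also a neighbour of the constant map \<open>i\<close>.

  So sending \<open>f\<close> to \<open>i\<close> is a graph homomorphism from \<open>E\<close> to \<open>K\<^sub>m\<close> that retracts \<open>E\<close> onto the
  constant maps, which form a copy of \<open>K\<^sub>m\<close>. This gives \<open>\<chi>(E) = m\<close>. On neighborhood complexes the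
  retraction followed by the inclusion is contiguous to the identity, because a common neighbour
  of a set \<open>A\<close> of maps is also a common neighbour of the constant maps assigned to \<open>A\<close>. Contiguous
  maps are homotopic along straight lines (\<open>homotopic_push\<close>), so \<open>\<N>(E)\<close> is homotopy equivalent to
  \<open>\<N>(K\<^sub>m)\<close>, the boundary of a simplex with \<open>m\<close> vertices, which is a sphere of dimension \<open>m - 2\<close>.

  It remains to see that the \<open>n\<close>-sphere has connectivity \<open>n - 1\<close>. It is not \<open>n\<close>-connected because
  it is not contractible. Conversely, let \<open>f\<close> be a map from the \<open>j\<close>-sphere to the \<open>n\<close>-sphere with
  \<open>j < n\<close>. The proof is a piecewise linear approximation in disguise
  (\<open>nullhomotopic_low_dimensional_sphere_map\<close>): the values of \<open>f\<close> near the points of a fine lattice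
  are blended with weight functions of which at most \<open>j + 2\<close> are nonzero at any point of the
  \<open>(j+1)\<close>-ball. The blended values then lie in finitely many affine subspaces of dimension at most
  \<open>j + 1 \<le> n\<close> of an \<open>(n+1)\<close>-dimensional space, and so miss some point close to the origin.
  Translating this point to the origin and normalising yields a map of the whole ball into the
  \<open>n\<close>-sphere whose restriction to the \<open>j\<close>-sphere is homotopic to \<open>f\<close>.
\<close>

section \<open>Exponential graphs and monochromatic edges\<close>

text \<open>
  The set of vertices adjacent to \<open>a\<close> or \<open>b\<close> contains both ends of the edge, and property \<open>\<P>\<close>
  closes it under adjacency: from the edge \<open>{a, b}\<close> to a disjoint edge \<open>{u, v}\<close> whose end \<open>u\<close> is
  in the set, it connects \<open>v\<close> to \<open>a\<close> or to \<open>b\<close>. Connectedness does the rest.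
\<close>

lemma edge_dominates:
  assumes "pair_graph T" "Digraph_Component.connected (with_proj T)" "property_P T"
    and ab: "(a, b) \<in> parcs T" and v: "v \<in> pverts T"
  shows "(v, a) \<in> parcs T \<or> (v, b) \<in> parcs T"
proof -
  interpret pair_graph T by fact
  have sym: "(x, y) \<in> parcs T \<Longrightarrow> (y, x) \<in> parcs T" for x y
    by (rule arcs_symmetric)
  have P: "(u, p) \<in> parcs T \<Longrightarrow> {p, q} \<inter> {u, v} = {} \<Longrightarrow> (p, q) \<in> parcs T \<Longrightarrow> (u, v) \<in> parcs T \<Longrightarrow>
        (v, p) \<in> parcs T \<or> (v, q) \<in> parcs T" for p q u v
    using assms(3) unfolding property_P_def by blast
  have "a \<rightarrow>\<^sup>*\<^bsub>with_proj (mk_symmetric (with_proj T))\<^esub> v"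
    using assms(2) v in_arcsD1[OF ab]
    by (auto simp: Digraph_Component.connected_def strongly_connected_def)
  moreover have "parcs (mk_symmetric (with_proj T)) = parcs T"
    using sym by (auto simp: parcs_mk_symmetric)
  ultimately have "(a, v) \<in> rtrancl_on (pverts T) (parcs T)"
    unfolding reachable_def by simp
  then have "(a, v) \<in> (parcs T)\<^sup>*"
    by (rule rtrancl_on_rtranclI)
  then show ?thesis
  proof (induction rule: rtrancl_induct)
    case base
    then show ?case using ab by blast
  next
    case (step u v)
    then have uv: "(v, u) \<in> parcs T" "(u, v) \<in> parcs T" using sym by blast+
    show ?case
    proof (cases "{u, v} \<inter> {a, b} = {}")
      case True
      then have *: "{a, b} \<inter> {u, v} = {}" "{b, a} \<inter> {u, v} = {}" by auto
      from step.IH show ?thesis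
      proof
        assume "(u, a) \<in> parcs T"
        from P[OF this *(1) ab uv(2)] show ?thesis .
      next
        assume "(u, b) \<in> parcs T"
        from P[OF this *(2) sym[OF ab] uv(2)] show ?thesis by blast
      qed
    next
      case False
      then consider "u = a" | "u = b" | "v = a" | "v = b" by blast
      then show ?thesis using ab sym uv by cases auto
    qed
  qed
qed

text \<open>
  The colour of an edge on which the map is constant. Only maps that have such an edge matter, and
  by \<open>neighbour_avoids_mono_colour\<close> any choice of the edge serves.
\<close>

definition mono_colour :: "'a pair_pre_digraph \<Rightarrow> ('a \<Rightarrow> 'c) \<Rightarrow> 'c" where
  "mono_colour T f = (SOME i. \<exists>a b. (a, b) \<in> parcs T \<and> f a = i \<and> f b = i)"

definition const_colouring :: "'a pair_pre_digraph \<Rightarrow> 'c \<Rightarrow> 'a \<Rightarrow> 'c" where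
  "const_colouring T i = (\<lambda>v\<in>pverts T. i)"

text \<open>
  Otherwise the map would be a proper colouring with fewer than \<open>\<chi>(T)\<close> colours.
\<close>

lemma ex_monochromatic_edge:
  assumes "pair_graph T" "m < chromatic_number T" "f \<in> pverts T \<rightarrow> {1..m}"
  shows "\<exists>a b. (a, b) \<in> parcs T \<and> f a = f b"
proof (rule ccontr)
  interpret pair_graph T by fact
  assume "\<not> ?thesis"
  then have "graph_hom T (complete_graph m) f"
    using assms(3) in_arcsD1 in_arcsD2
    by (auto simp: graph_hom_def complete_graph_def Pi_iff)
  then show False
    using assms(2) not_less_Least unfolding chromatic_number_def by blast
qed

lemma mono_colour_edge:
  assumes "pair_graph T" "m < chromatic_number T" "f \<in> pverts T \<rightarrow> {1..m}"
  obtains a b where "(a, b) \<in> parcs T" "f a = mono_colour T f" "f b = mono_colour T f"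
proof -
  have "\<exists>i a b. (a, b) \<in> parcs T \<and> f a = i \<and> f b = i"
    using ex_monochromatic_edge[OF assms] by metis
  from someI_ex[OF this] that show ?thesis
    unfolding mono_colour_def by blast
qed

text \<open>
  Every vertex \<open>v\<close> is adjacent to an end of the monochromatic edge, so adjacency of \<open>f\<close> and \<open>g\<close>
  forbids its colour at \<open>v\<close>.
\<close>

lemma neighbour_avoids_mono_colour:
  assumes T: "pair_graph T" "Digraph_Component.connected (with_proj T)" "property_P T"
      "m < chromatic_number T"
    and fg: "(f, g) \<in> parcs (exp_graph (complete_graph m) T)" and v: "v \<in> pverts T"
  shows "g v \<noteq> mono_colour T f"
proof -
  interpret pair_graph T by fact
  have "f \<in> pverts T \<rightarrow> {1..m}"
    using fg by (auto simp: exp_graph_def complete_graph_def PiE_iff)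
  then obtain a b where ab: "(a, b) \<in> parcs T" "f a = mono_colour T f" "f b = mono_colour T f"
    by (rule mono_colour_edge[OF T(1,4)])
  have "(a, v) \<in> parcs T \<or> (b, v) \<in> parcs T"
    using edge_dominates[OF T(1-3) ab(1) v] arcs_symmetric by blast
  then show ?thesis
    using fg ab(2,3) by (fastforce simp: exp_graph_def complete_graph_def)
qed

text \<open>
  A neighbour of \<open>f\<close> avoids the colour assigned to \<open>f\<close> everywhere, in particular on the edge
  that determines its own colour.
\<close>

lemma mono_colour_hom:
  assumes T: "pair_graph T" "Digraph_Component.connected (with_proj T)" "property_P T"
      "m < chromatic_number T"
  shows "graph_hom (exp_graph (complete_graph m) T) (complete_graph m) (mono_colour T)"
proof -
  interpret pair_graph T by fact
  have range: "mono_colour T f \<in> {1..m}" if "f \<in> pverts T \<rightarrow>\<^sub>E {1..m}" for f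
  proof -
    have f: "f \<in> pverts T \<rightarrow> {1..m}" using that by (auto simp: PiE_iff)
    from mono_colour_edge[OF T(1,4) f] obtain a b
      where "(a, b) \<in> parcs T" "f a = mono_colour T f" .
    then show ?thesis using f in_arcsD1 by (metis PiE)
  qed
  moreover have "mono_colour T f \<noteq> mono_colour T g"
    if "(f, g) \<in> parcs (exp_graph (complete_graph m) T)" for f g
  proof -
    have "g \<in> pverts T \<rightarrow> {1..m}"
      using that by (auto simp: exp_graph_def complete_graph_def PiE_iff)
    from mono_colour_edge[OF T(1,4) this] obtain a b
      where ab: "(a, b) \<in> parcs T" "g a = mono_colour T g" .
    then show ?thesis
      using neighbour_avoids_mono_colour[OF T that in_arcsD1[OF ab(1)]] by simp
  qed
  ultimately show ?thesis
    unfolding graph_hom_def by (auto simp: exp_graph_def complete_graph_def)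
qed

lemma const_colouring_hom:
  assumes "pair_graph T"
  shows "graph_hom (complete_graph m) (exp_graph (complete_graph m) T) (const_colouring T)"
proof -
  interpret pair_graph T by fact
  show ?thesis
    using in_arcsD1 in_arcsD2
    by (auto simp: graph_hom_def exp_graph_def complete_graph_def const_colouring_def)
qed

lemma mono_colour_const:
  assumes "pair_graph T" "m < chromatic_number T" "i \<in> {1..m}"
  shows "mono_colour T (const_colouring T i) = i"
proof -
  interpret pair_graph T by fact
  have "const_colouring T i \<in> pverts T \<rightarrow> {1..m}"
    using assms(3) by (auto simp: const_colouring_def)
  from mono_colour_edge[OF assms(1,2) this] obtain a b
    where "(a, b) \<in> parcs T" "const_colouring T i a = mono_colour T (const_colouring T i)" .
  then show ?thesis
    using in_arcsD1 by (simp add: const_colouring_def)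
qed

text \<open>
  The vertex \<open>f\<close> of the exponential graph is dominated by a constant map: the neighborhood of \<open>f\<close>
  is contained in that of the constant map with the colour of \<open>f\<close>.
\<close>

lemma neighbour_of_const_mono_colour:
  assumes T: "pair_graph T" "Digraph_Component.connected (with_proj T)" "property_P T"
      "m < chromatic_number T"
    and gf: "(g, f) \<in> parcs (exp_graph (complete_graph m) T)"
  shows "(g, const_colouring T (mono_colour T f)) \<in> parcs (exp_graph (complete_graph m) T)"
proof -
  interpret pair_graph T by fact
  have fg: "(f, g) \<in> parcs (exp_graph (complete_graph m) T)"
    using gf arcs_symmetric by (fastforce simp: exp_graph_def complete_graph_def)
  have "f \<in> pverts (exp_graph (complete_graph m) T)"
    using gf by (simp add: exp_graph_def)
  then have "mono_colour T f \<in> {1..m}"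
    using mono_colour_hom[OF T] by (auto simp: graph_hom_def complete_graph_def)
  then show ?thesis
    using gf neighbour_avoids_mono_colour[OF T fg] in_arcsD1 in_arcsD2
    by (auto simp: exp_graph_def complete_graph_def const_colouring_def PiE_iff)
qed

text \<open>
  The upper bound is \<open>mono_colour_hom\<close>. For the lower bound, the constant maps form a clique with
  \<open>m\<close> vertices.
\<close>

lemma chromatic_number_exp_graph:
  assumes T: "pair_graph T" "Digraph_Component.connected (with_proj T)" "property_P T"
      "m < chromatic_number T"
  shows "chromatic_number (exp_graph (complete_graph m) T) = m"
  unfolding chromatic_number_def
proof (rule Least_equality)
  show "\<exists>f. graph_hom (exp_graph (complete_graph m) T) (complete_graph m) f"
    using mono_colour_hom[OF T] by blast
next
  fix n assume "\<exists>f. graph_hom (exp_graph (complete_graph m) T) (complete_graph n) f"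
  then obtain f where f: "graph_hom (exp_graph (complete_graph m) T) (complete_graph n) f" ..
  have c: "graph_hom (complete_graph m) (exp_graph (complete_graph m) T) (const_colouring T)"
    by (rule const_colouring_hom[OF T(1)])
  have "graph_hom (complete_graph m) (complete_graph n) (f \<circ> const_colouring T)"
    using f c by (auto simp: graph_hom_def Pi_iff)
  then have "inj_on (f \<circ> const_colouring T) {1..m}" "(f \<circ> const_colouring T) ` {1..m} \<subseteq> {1..n}"
    unfolding graph_hom_def complete_graph_def inj_on_def by fastforce+
  from card_inj_on_le[OF this] show "m \<le> n" by simp
qed

section \<open>Contiguous simplicial maps\<close>

text \<open>
  The points of the geometric realization, as a set. Its topology is the subspace topology of a
  type-class topology, which makes continuity a matter of coordinates.
\<close>

definition barycentric :: "'a set set \<Rightarrow> ('a \<Rightarrow> real) set" where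
  "barycentric S =
     {t. (\<forall>v. 0 \<le> t v) \<and> {v. t v \<noteq> 0} \<in> S \<and> (\<Sum>v | t v \<noteq> 0. t v) = 1}"

lemma geometric_realization_eq: "geometric_realization S = top_of_set (barycentric S)"
  by (simp add: geometric_realization_def barycentric_def euclidean_product_topology)

lemma continuous_on_coordinate [continuous_intros]:
  "continuous_on A (\<lambda>x :: 'a \<Rightarrow> real. x i)"
  by (rule continuous_on_product_then_coordinatewise[OF continuous_on_id])

lemma continuous_on_snd_coordinate [continuous_intros]:
  "continuous_on A (\<lambda>p :: 'b::topological_space \<times> ('a \<Rightarrow> real). snd p i)"
  by (rule continuous_on_product_then_coordinatewise[OF continuous_on_snd[OF continuous_on_id]])

text \<open>
  The affine extension of the vertex map \<open>\<phi>\<close> to barycentric coordinates: the weight of \<open>w\<close> is the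
  total weight of its fibre. The finite set \<open>V\<close> contains all vertices, so that the sum is finite at
  every argument.
\<close>

definition push :: "'a set \<Rightarrow> ('a \<Rightarrow> 'b) \<Rightarrow> ('a \<Rightarrow> real) \<Rightarrow> 'b \<Rightarrow> real" where
  "push V \<phi> t w = (\<Sum>v\<in>{v\<in>V. \<phi> v = w}. t v)"

lemma barycentric_iff:
  assumes "finite V" "S \<subseteq> Pow V"
  shows "t \<in> barycentric S \<longleftrightarrow>
    (\<forall>v. 0 \<le> t v) \<and> {v. t v \<noteq> 0} \<in> S \<and> (\<forall>v. v \<notin> V \<longrightarrow> t v = 0) \<and> sum t V = 1"
proof -
  have "sum t {v. t v \<noteq> 0} = sum t V" if "{v. t v \<noteq> 0} \<subseteq> V"
    using that assms(1) by (intro sum.mono_neutral_left) auto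
  then show ?thesis
    using assms(2) unfolding barycentric_def mem_Collect_eq by (metis (mono_tags, lifting) PowD mem_Collect_eq subset_iff)
qed

lemma sum_push:
  assumes "finite V" "finite W" "\<phi> ` V \<subseteq> W"
  shows "sum (push V \<phi> t) W = sum t V"
  unfolding push_def using sum.group[OF assms, of t] by simp

lemma push_nonneg: "(\<And>v. 0 \<le> t v) \<Longrightarrow> 0 \<le> push V \<phi> t w"
  by (simp add: push_def sum_nonneg)

lemma support_push:
  assumes "finite V" "\<And>v. 0 \<le> t v" "\<And>v. v \<notin> V \<Longrightarrow> t v = 0"
  shows "{w. push V \<phi> t w \<noteq> 0} = \<phi> ` {v. t v \<noteq> 0}"
proof -
  have "push V \<phi> t w = 0 \<longleftrightarrow> (\<forall>v\<in>V. \<phi> v = w \<longrightarrow> t v = 0)" for w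
    unfolding push_def using assms(1,2) by (subst sum_nonneg_eq_0_iff) auto
  then show ?thesis
    using assms(3) by auto
qed

lemma push_push:
  assumes "finite V" "finite W" "\<phi> ` V \<subseteq> W"
  shows "push W \<psi> (push V \<phi> t) = push V (\<psi> \<circ> \<phi>) t"
proof
  fix x
  have "push W \<psi> (push V \<phi> t) x
      = (\<Sum>w\<in>{w\<in>W. \<psi> w = x}. \<Sum>v\<in>{v\<in>{v\<in>V. \<psi> (\<phi> v) = x}. \<phi> v = w}. t v)"
    unfolding push_def by (intro sum.cong) auto
  also have "\<dots> = push V (\<psi> \<circ> \<phi>) t x"
    unfolding push_def comp_def using assms by (intro sum.group) auto
  finally show "push W \<psi> (push V \<phi> t) x = push V (\<psi> \<circ> \<phi>) t x" .
qed

lemma push_ident: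
  assumes "finite V" "\<And>v. v \<notin> V \<Longrightarrow> t v = 0" "\<And>v. v \<in> V \<Longrightarrow> \<phi> v = v"
  shows "push V \<phi> t = t"
proof
  fix w
  have "{v\<in>V. \<phi> v = w} = (if w \<in> V then {w} else {})"
    using assms(3) by auto
  then show "push V \<phi> t w = t w"
    using assms(2) by (simp add: push_def)
qed

text \<open>
  Two simplicial maps are contiguous if the images of each simplex together span a simplex. The
  segment between the two images of a point then lies in that simplex, and the straight-line
  homotopy stays inside \<open>L\<close>. With \<open>\<phi> = \<psi>\<close> this also gives the continuity of \<open>push V \<phi>\<close>.
\<close>

lemma homotopic_push:
  assumes fin: "finite V" "finite W" and K: "K \<subseteq> Pow V" and L: "L \<subseteq> Pow W"
    and down: "\<And>A B. A \<in> L \<Longrightarrow> B \<subseteq> A \<Longrightarrow> B \<in> L"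
    and maps: "\<phi> ` V \<subseteq> W" "\<psi> ` V \<subseteq> W"
    and contiguous: "\<And>A. A \<in> K \<Longrightarrow> \<phi> ` A \<union> \<psi> ` A \<in> L"
  shows "homotopic_with (\<lambda>_. True) (geometric_realization K) (geometric_realization L)
           (push V \<phi>) (push V \<psi>)"
proof -
  define h where "h = (\<lambda>(s, t) w. (1 - s) * push V \<phi> t w + s * push V \<psi> t w)"
  have "continuous_on ({0..1} \<times> barycentric K) h"
    unfolding h_def case_prod_unfold push_def
    by (intro continuous_intros)
  moreover have "h (s, t) \<in> barycentric L" if s: "s \<in> {0..1}" and t: "t \<in> barycentric K" for s t
  proof -
    note t' = t[unfolded barycentric_iff[OF fin(1) K]]
    have supp: "{w. push V \<phi> t w \<noteq> 0} = \<phi> ` {v. t v \<noteq> 0}"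
        "{w. push V \<psi> t w \<noteq> 0} = \<psi> ` {v. t v \<noteq> 0}"
      by (intro support_push; use t' fin(1) in blast)+
    have "{w. h (s, t) w \<noteq> 0} \<subseteq> {w. push V \<phi> t w \<noteq> 0} \<union> {w. push V \<psi> t w \<noteq> 0}"
      by (auto simp: h_def)
    moreover have "\<dots> \<in> L"
      unfolding supp using t' by (intro contiguous) auto
    ultimately have "{w. h (s, t) w \<noteq> 0} \<in> L"
      by (rule down[rotated])
    moreover have "0 \<le> h (s, t) w" for w
      using s t' by (auto simp: h_def push_nonneg)
    moreover have "sum (h (s, t)) W = 1"
      using t' by (simp add: h_def sum.distrib flip: sum_distrib_left)
        (simp add: sum_push[OF fin maps(1)] sum_push[OF fin maps(2)])
    ultimately show ?thesis
      using L unfolding barycentric_iff[OF fin(2) L] by blast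
  qed
  ultimately show ?thesis
    unfolding homotopic_with_def geometric_realization_eq
    by (intro exI[of _ h]) (auto simp: h_def image_subset_iff subset_iff)
qed

lemma homotopy_equivalent_contiguous_retract:
  assumes fin: "finite V" "finite W" and K: "K \<subseteq> Pow V" and L: "L \<subseteq> Pow W"
    and down: "\<And>A B. A \<in> K \<Longrightarrow> B \<subseteq> A \<Longrightarrow> B \<in> K" "\<And>A B. A \<in> L \<Longrightarrow> B \<subseteq> A \<Longrightarrow> B \<in> L"
    and maps: "\<phi> ` V \<subseteq> W" "\<psi> ` W \<subseteq> V"
    and simplicial: "\<And>A. A \<in> K \<Longrightarrow> \<phi> ` A \<in> L" "\<And>A. A \<in> L \<Longrightarrow> \<psi> ` A \<in> K"
    and retract: "\<And>w. w \<in> W \<Longrightarrow> \<phi> (\<psi> w) = w"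
    and contiguous: "\<And>A. A \<in> K \<Longrightarrow> \<psi> ` \<phi> ` A \<union> A \<in> K"
  shows "geometric_realization K homotopy_equivalent_space geometric_realization L"
proof -
  have "homotopic_with (\<lambda>_. True) (geometric_realization K) (geometric_realization L)
      (push V \<phi>) (push V \<phi>)"
    using simplicial(1) maps by (intro homotopic_push[OF fin K L down(2)]) auto
  then have 1: "continuous_map (geometric_realization K) (geometric_realization L) (push V \<phi>)"
    by (rule homotopic_with_imp_continuous_maps[THEN conjunct1])
  have "homotopic_with (\<lambda>_. True) (geometric_realization L) (geometric_realization K)
      (push W \<psi>) (push W \<psi>)"
    using simplicial(2) maps by (intro homotopic_push[OF fin(2,1) L K down(1)]) auto
  then have 2: "continuous_map (geometric_realization L) (geometric_realization K) (push W \<psi>)"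
    by (rule homotopic_with_imp_continuous_maps[THEN conjunct1])
  have "homotopic_with (\<lambda>_. True) (geometric_realization K) (geometric_realization K)
      (push V (\<psi> \<circ> \<phi>)) (push V id)"
    using contiguous maps by (intro homotopic_push[OF fin(1,1) K K down(1)]) (auto simp: image_comp)
  moreover have "push V (\<psi> \<circ> \<phi>) = push W \<psi> \<circ> push V \<phi>"
    using push_push[OF fin maps(1), of \<psi>] by (simp add: fun_eq_iff)
  moreover have "push V id t = t" if "t \<in> topspace (geometric_realization K)" for t
    using that fin(1) barycentric_iff[OF fin(1) K] unfolding geometric_realization_eq
    by (intro push_ident) auto
  ultimately have 3: "homotopic_with (\<lambda>_. True) (geometric_realization K) (geometric_realization K)
      (push W \<psi> \<circ> push V \<phi>) id"
    by (elim homotopic_with_eq) auto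
  have "(push V \<phi> \<circ> push W \<psi>) t = t" if "t \<in> topspace (geometric_realization L)" for t
  proof -
    have "push W (\<phi> \<circ> \<psi>) t = t"
      using that fin(2) retract barycentric_iff[OF fin(2) L] unfolding geometric_realization_eq
      by (intro push_ident) auto
    then show ?thesis
      using push_push[OF fin(2,1) maps(2), of \<phi>] by simp
  qed
  then have 4: "homotopic_with (\<lambda>_. True) (geometric_realization L) (geometric_realization L)
      (push V \<phi> \<circ> push W \<psi>) id"
    using 1 2 by (intro homotopic_with_equal) (auto intro: continuous_map_compose)
  show ?thesis
    unfolding homotopy_equivalent_space_def using 1 2 3 4 by blast
qed

section \<open>Connectivity and null-homotopic sphere maps\<close>

definition sphere_points :: "nat \<Rightarrow> (nat \<Rightarrow> real) set" where
  "sphere_points n = {x. (\<Sum>i\<le>n. (x i)\<^sup>2) = 1 \<and> (\<forall>i>n. x i = 0)}"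

definition ball_points :: "nat \<Rightarrow> (nat \<Rightarrow> real) set" where
  "ball_points n = {x. (\<Sum>i\<le>n. (x i)\<^sup>2) \<le> 1 \<and> (\<forall>i>n. x i = 0)}"

text \<open>
  Euclidean space of dimension \<open>n + 1\<close> without the origin, where \<open>normalise n\<close> is the radial
  projection to the \<open>n\<close>-sphere.
\<close>

definition nonzero_points :: "nat \<Rightarrow> (nat \<Rightarrow> real) set" where
  "nonzero_points n = {x. (\<exists>i\<le>n. x i \<noteq> 0) \<and> (\<forall>i>n. x i = 0)}"

definition normalise :: "nat \<Rightarrow> (nat \<Rightarrow> real) \<Rightarrow> nat \<Rightarrow> real" where
  "normalise n x i = x i / sqrt (\<Sum>k\<le>n. (x k)\<^sup>2)"

lemma nsphere_eq: "nsphere n = top_of_set (sphere_points n)"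
  by (simp add: nsphere sphere_points_def euclidean_product_topology)

lemma nball_eq: "nball (Suc n) = top_of_set (ball_points n)"
proof -
  have "{x. \<forall>i\<ge>Suc n. x i = 0} \<inter> {x. (\<Sum>i<Suc n. (x i)\<^sup>2) \<le> 1} = ball_points n"
    unfolding ball_points_def lessThan_Suc_atMost Suc_le_eq by blast
  then show ?thesis
    unfolding nball_def Euclidean_space_def euclidean_product_topology subtopology_subtopology by simp
qed

lemma sphere_subset_ball: "sphere_points n \<subseteq> ball_points n"
  by (auto simp: sphere_points_def ball_points_def)

lemma sum_squares_pos: "x \<in> nonzero_points n \<Longrightarrow> 0 < (\<Sum>k\<le>n. (x k)\<^sup>2)" for x :: "nat \<Rightarrow> real"
  by (auto simp: nonzero_points_def intro!: sum_pos2)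

lemma sphere_subset_nonzero: "sphere_points n \<subseteq> nonzero_points n"
proof
  fix x assume x: "x \<in> sphere_points n"
  have "\<exists>i\<le>n. x i \<noteq> 0"
  proof (rule ccontr)
    assume "\<not> ?thesis"
    then have "(\<Sum>k\<le>n. (x k)\<^sup>2) = 0" by simp
    then show False using x by (simp add: sphere_points_def)
  qed
  then show "x \<in> nonzero_points n"
    using x by (simp add: sphere_points_def nonzero_points_def)
qed

lemma normalise_in_sphere: "x \<in> nonzero_points n \<Longrightarrow> normalise n x \<in> sphere_points n"
  using sum_squares_pos[of x n]
  by (auto simp: sphere_points_def normalise_def nonzero_points_def power_divide
      simp flip: sum_divide_distrib)

lemma normalise_sphere: "x \<in> sphere_points n \<Longrightarrow> normalise n x = x"
  by (auto simp: sphere_points_def normalise_def)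

lemma continuous_on_normalise:
  assumes "continuous_on A f" "\<And>x. x \<in> A \<Longrightarrow> f x \<in> nonzero_points n"
  shows "continuous_on A (\<lambda>x. normalise n (f x))"
  unfolding normalise_def
  using sum_squares_pos[OF assms(2)]
  by (intro continuous_on_coordinatewise_then_product continuous_on_divide continuous_on_real_sqrt
      continuous_on_sum continuous_on_power continuous_on_product_then_coordinatewise[OF assms(1)]) force

text \<open>
  Shrink the sphere to the centre of the ball.
\<close>

lemma nullhomotopic_if_extends:
  assumes g: "continuous_map (nball (Suc n)) X g" "\<And>x. x \<in> topspace (nsphere n) \<Longrightarrow> g x = f x"
  shows "\<exists>c. homotopic_with (\<lambda>_. True) (nsphere n) X f (\<lambda>_. c)"
proof -
  let ?h = "\<lambda>(t, x) i. (1 - t) * x i :: real"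
  have "?h (t, x) \<in> ball_points n" if "t \<in> {0..1}" "x \<in> sphere_points n" for t x
  proof -
    have "(1 - t)\<^sup>2 \<le> 1"
      using that(1) by (simp add: power_le_one)
    then show ?thesis
      using that(2) by (simp add: ball_points_def sphere_points_def power_mult_distrib flip: sum_distrib_left)
  qed
  moreover have "continuous_on ({0..1} \<times> sphere_points n) ?h"
    unfolding case_prod_unfold by (intro continuous_intros)
  ultimately have "continuous_map (prod_topology (top_of_set {0..1}) (nsphere n)) (nball (Suc n)) ?h"
    unfolding nsphere_eq nball_eq by auto
  then have "continuous_map (prod_topology (top_of_set {0..1}) (nsphere n)) X (g \<circ> ?h)"
    using g(1) by (rule continuous_map_compose)
  then have "homotopic_with (\<lambda>_. True) (nsphere n) X g (\<lambda>_. g (\<lambda>_. 0))"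
    unfolding homotopic_with_def by (intro exI[of _ "g \<circ> ?h"]) auto
  then have "homotopic_with (\<lambda>_. True) (nsphere n) X f (\<lambda>_. g (\<lambda>_. 0))"
    by (rule homotopic_with_eq) (auto simp: g(2))
  then show ?thesis ..
qed

text \<open>
  The extension is constant on the ball of radius \<open>1/2\<close> and runs through the null-homotopy on the
  shell outside it. The inner ball keeps the radial projection away from the origin.
\<close>

lemma extends_if_nullhomotopic:
  assumes "homotopic_with (\<lambda>_. True) (nsphere n) X f (\<lambda>_. c)"
  shows "\<exists>g. continuous_map (nball (Suc n)) X g \<and> (\<forall>x\<in>topspace (nsphere n). g x = f x)"
proof -
  from assms obtain h where h: "continuous_map (prod_topology (top_of_set {0..1::real}) (nsphere n)) X h"
    and h0: "\<forall>x. h (0, x) = f x" and h1: "\<forall>x. h (1, x) = c"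
    unfolding homotopic_with_def by blast
  define r where "r x = sqrt (\<Sum>k\<le>n. (x k)\<^sup>2)" for x :: "nat \<Rightarrow> real"
  define g where "g x = (if 1 / 2 \<le> r x then (h \<circ> (\<lambda>x. (2 - 2 * r x, normalise n x))) x else c)" for x
  have c: "c \<in> topspace X"
    using homotopic_with_imp_continuous_maps[OF assms] in_topspace_nsphere[of n]
    by (auto simp: continuous_map_def)
  have r: "continuous_on A r" for A
    unfolding r_def by (intro continuous_intros)
  have nz: "x \<in> nonzero_points n" if "x \<in> ball_points n" "1 / 2 \<le> r x" for x
  proof -
    have "(\<Sum>k\<le>n. (x k)\<^sup>2) \<noteq> 0" using that(2) by (auto simp: r_def)
    then have "\<exists>k\<in>{..n}. (x k)\<^sup>2 \<noteq> 0"
      using sum.neutral[of "{..n}" "\<lambda>k. (x k)\<^sup>2"] by blast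
    then show ?thesis using that(1) by (auto simp: nonzero_points_def ball_points_def)
  qed
  have sub: "subtopology (nball (Suc n)) {x \<in> topspace (nball (Suc n)). 1 / 2 \<le> r x}
      = top_of_set {x \<in> ball_points n. 1 / 2 \<le> r x}"
    by (auto simp: nball_eq subtopology_subtopology intro!: arg_cong[where f=top_of_set])
  have "continuous_map (nball (Suc n)) X g"
    unfolding g_def
  proof (rule continuous_map_cases_le)
    show "continuous_map (nball (Suc n)) euclideanreal r"
      unfolding nball_eq by (simp add: r)
    show "continuous_map (subtopology (nball (Suc n)) {x \<in> topspace (nball (Suc n)). 1 / 2 \<le> r x}) X
        (h \<circ> (\<lambda>x. (2 - 2 * r x, normalise n x)))"
      unfolding sub
    proof (rule continuous_map_compose[OF _ h])
      have "continuous_on {x \<in> ball_points n. 1 / 2 \<le> r x} (\<lambda>x. (2 - 2 * r x, normalise n x))"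
        using nz by (intro continuous_intros r continuous_on_normalise) auto
      moreover have "r x \<le> 1" if "x \<in> ball_points n" for x
        using that by (simp add: r_def ball_points_def)
      ultimately show "continuous_map (top_of_set {x \<in> ball_points n. 1 / 2 \<le> r x})
          (prod_topology (top_of_set {0..1}) (nsphere n)) (\<lambda>x. (2 - 2 * r x, normalise n x))"
        unfolding nsphere_eq using nz normalise_in_sphere by auto
    qed
    show "(h \<circ> (\<lambda>x. (2 - 2 * r x, normalise n x))) x = c"
      if "x \<in> topspace (nball (Suc n))" "1 / 2 = r x" for x
    proof -
      have "2 - 2 * r x = 1" using that(2) by simp
      then show ?thesis by (simp add: h1)
    qed
  qed (use c in auto)
  moreover have "g x = f x" if "x \<in> topspace (nsphere n)" for x
  proof -
    have x: "x \<in> sphere_points n" using that by (simp add: nsphere_eq)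
    then have "r x = 1" by (simp add: r_def sphere_points_def)
    then show ?thesis by (simp add: g_def normalise_sphere[OF x] h0)
  qed
  ultimately show ?thesis by blast
qed

lemma k_connected_iff_nullhomotopic:
  "k_connected k X \<longleftrightarrow>
     (\<forall>j. int j \<le> k \<longrightarrow> (\<forall>f. continuous_map (nsphere j) X f \<longrightarrow>
        (\<exists>c. homotopic_with (\<lambda>_. True) (nsphere j) X f (\<lambda>_. c))))"
proof -
  have "(\<exists>g. continuous_map (nball (Suc j)) X g \<and> (\<forall>x\<in>topspace (nsphere j). g x = f x)) \<longleftrightarrow>
      (\<exists>c. homotopic_with (\<lambda>_. True) (nsphere j) X f (\<lambda>_. c))" for j f
    using nullhomotopic_if_extends[of j X _ f] extends_if_nullhomotopic[of j X f] by blast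
  then show ?thesis unfolding k_connected_def by simp
qed

text \<open>
  Transport a sphere map in \<open>Y\<close> to \<open>X\<close>, contract it there, and transport the contraction back; the
  round trip is homotopic to the identity. This is where connectivity is needed in terms of
  null-homotopies, since extension to the ball is not visibly invariant.
\<close>

lemma k_connected_homotopy_equivalent:
  assumes "X homotopy_equivalent_space Y" "k_connected k X"
  shows "k_connected k Y"
  unfolding k_connected_iff_nullhomotopic
proof (intro allI impI)
  fix j f assume j: "int j \<le> k" and f: "continuous_map (nsphere j) Y f"
  from assms(1) obtain a b where a: "continuous_map X Y a" and b: "continuous_map Y X b"
    and ab: "homotopic_with (\<lambda>_. True) Y Y (a \<circ> b) id"
    unfolding homotopy_equivalent_space_def by blast
  obtain c where "homotopic_with (\<lambda>_. True) (nsphere j) X (b \<circ> f) (\<lambda>_. c)"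
    using assms(2) j continuous_map_compose[OF f b]
    unfolding k_connected_iff_nullhomotopic by blast
  then have "homotopic_with (\<lambda>_. True) (nsphere j) Y (a \<circ> (b \<circ> f)) (a \<circ> (\<lambda>_. c))"
    using a by (rule homotopic_with_compose_continuous_map_left) simp
  moreover have "homotopic_with (\<lambda>_. True) (nsphere j) Y ((a \<circ> b) \<circ> f) (id \<circ> f)"
    using ab f by (rule homotopic_with_compose_continuous_map_right) simp
  ultimately have "homotopic_with (\<lambda>_. True) (nsphere j) Y f (\<lambda>_. a c)"
    using homotopic_with_symD homotopic_with_trans by (fastforce simp: comp_def)
  then show "\<exists>c. homotopic_with (\<lambda>_. True) (nsphere j) Y f (\<lambda>_. c)" ..
qed

lemma conn_homotopy_equivalent:
  assumes "X homotopy_equivalent_space Y"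
  shows "conn X = conn Y"
proof -
  have "k_connected k X \<longleftrightarrow> k_connected k Y" for k
    using k_connected_homotopy_equivalent[of X Y] k_connected_homotopy_equivalent[of Y X] assms
      homotopy_equivalent_space_sym[of X Y] by blast
  then show ?thesis by (simp add: conn_def)
qed

section \<open>The boundary of a simplex is a sphere\<close>

lemma continuous_on_Min:
  fixes f :: "'i \<Rightarrow> 'a::topological_space \<Rightarrow> real"
  assumes "finite I" "I \<noteq> {}" "\<And>i. i \<in> I \<Longrightarrow> continuous_on A (f i)"
  shows "continuous_on A (\<lambda>x. Min ((\<lambda>i. f i x) ` I))"
  using assms
proof (induction rule: finite_ne_induct)
  case (insert i I)
  then have "continuous_on A (\<lambda>x. min (f i x) (Min ((\<lambda>i. f i x) ` I)))"
    by (intro continuous_on_min) auto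
  with insert show ?case by simp
qed simp

text \<open>
  The proper faces of the simplex with \<open>n + 2\<close> vertices.
\<close>

definition simplex_boundary :: "nat \<Rightarrow> nat set set" where
  "simplex_boundary n = {A. A \<subset> {1..n + 2}}"

text \<open>
  Up to scale, a point of the boundary is determined by the differences of its coordinates to the
  last one, since the smallest coordinate is \<open>0\<close>. The inverse map therefore reads \<open>x\<close> as a vector
  with \<open>n + 2\<close> coordinates (the last one being \<open>0\<close>), subtracts the smallest coordinate, and
  rescales to total weight \<open>1\<close>. The vertices are numbered from \<open>1\<close>, the coordinates of Euclidean
  space from \<open>0\<close>.
\<close>

definition boundary_to_sphere :: "nat \<Rightarrow> (nat \<Rightarrow> real) \<Rightarrow> nat \<Rightarrow> real" where
  "boundary_to_sphere n t = normalise n (\<lambda>i. if i \<le> n then t (Suc i) - t (n + 2) else 0)"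

definition sphere_to_boundary :: "nat \<Rightarrow> (nat \<Rightarrow> real) \<Rightarrow> nat \<Rightarrow> real" where
  "sphere_to_boundary n x i =
     (if i \<in> {1..n + 2}
      then (x (i - 1) - Min (x ` {..Suc n})) / (\<Sum>k\<le>Suc n. x k - Min (x ` {..Suc n})) else 0)"

lemma sphere_to_boundary_off: "i \<notin> {1..n + 2} \<Longrightarrow> sphere_to_boundary n x i = 0"
  unfolding sphere_to_boundary_def by (rule if_not_P)

lemma sum_shift: "(\<Sum>i\<in>{1..n + 2}. g i) = (\<Sum>k\<le>Suc n. g (Suc k))" for g :: "nat \<Rightarrow> real"
proof -
  have "{1..n + 2} = Suc ` {..Suc n}"
    unfolding image_Suc_atMost by simp
  then show ?thesis
    by (simp only: sum.reindex[OF inj_Suc] comp_def)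
qed

lemma barycentric_simplex_boundary:
  "t \<in> barycentric (simplex_boundary n) \<longleftrightarrow>
     (\<forall>i. 0 \<le> t i) \<and> (\<forall>i. i \<notin> {1..n + 2} \<longrightarrow> t i = 0) \<and> (\<exists>k\<le>Suc n. t (Suc k) = 0) \<and>
     (\<Sum>k\<le>Suc n. t (Suc k)) = 1"
proof -
  have "simplex_boundary n \<subseteq> Pow {1..n + 2}"
    by (auto simp: simplex_boundary_def)
  note iff = barycentric_iff[OF finite_atLeastAtMost this, of t, unfolded sum_shift]
  have "{i. t i \<noteq> 0} \<in> simplex_boundary n \<longleftrightarrow> (\<exists>k\<le>Suc n. t (Suc k) = 0)"
    if "\<forall>i. i \<notin> {1..n + 2} \<longrightarrow> t i = 0"
  proof -
    have "{i. t i \<noteq> 0} \<in> simplex_boundary n \<longleftrightarrow> (\<exists>i\<in>{1..n + 2}. t i = 0)"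
      using that unfolding simplex_boundary_def by blast
    also have "{1..n + 2} = Suc ` {..Suc n}"
      unfolding image_Suc_atMost by simp
    finally show ?thesis by auto
  qed
  then show ?thesis unfolding iff by blast
qed

text \<open>
  If all differences vanished, then all coordinates would equal the smallest one, which is \<open>0\<close>.
\<close>

lemma simplex_difference_nonzero:
  assumes "t \<in> barycentric (simplex_boundary n)"
  shows "(\<lambda>i. if i \<le> n then t (Suc i) - t (n + 2) else 0) \<in> nonzero_points n"
proof -
  note t = assms[unfolded barycentric_simplex_boundary]
  have "\<exists>i\<le>n. t (Suc i) \<noteq> t (n + 2)"
  proof (rule ccontr)
    assume "\<not> ?thesis"
    then have eq: "t (Suc k) = t (n + 2)" if "k \<le> Suc n" for k
      using that by (cases "k = Suc n") auto
    have "t (n + 2) = 0"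
      using t eq by metis
    then have "t (Suc k) = 0" if "k \<le> Suc n" for k
      using eq[OF that] by simp
    then have "(\<Sum>k\<le>Suc n. t (Suc k)) = 0"
      by (intro sum.neutral) simp
    then show False using t by simp
  qed
  then show ?thesis by (auto simp: nonzero_points_def)
qed

text \<open>
  A point of the sphere has a nonzero coordinate and, in position \<open>n + 1\<close>, a zero coordinate. So it
  is not constant on the first \<open>n + 2\<close> positions, and the rescaling factor is positive.
\<close>

lemma sphere_minus_Min:
  assumes "x \<in> sphere_points n"
  shows "\<And>k. k \<le> Suc n \<Longrightarrow> Min (x ` {..Suc n}) \<le> x k"
    and "0 < (\<Sum>k\<le>Suc n. x k - Min (x ` {..Suc n}))"
proof -
  let ?\<mu> = "Min (x ` {..Suc n})"
  show \<mu>: "?\<mu> \<le> x k" if "k \<le> Suc n" for k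
    using that by (intro Min_le) auto
  obtain i where i: "i \<le> n" "x i \<noteq> 0"
    using subsetD[OF sphere_subset_nonzero assms] by (auto simp: nonzero_points_def)
  have "x (Suc n) = 0" using assms by (simp add: sphere_points_def)
  then have "\<exists>k\<le>Suc n. ?\<mu> < x k"
    using \<mu>[of i] \<mu>[of "Suc n"] i by (metis le_SucI less_eq_real_def order_refl order.strict_trans1)
  then show "0 < (\<Sum>k\<le>Suc n. x k - ?\<mu>)"
    using \<mu> by (auto intro!: sum_pos2 simp del: sum.atMost_Suc)
qed

lemma sphere_to_boundary_in:
  assumes x: "x \<in> sphere_points n"
  shows "sphere_to_boundary n x \<in> barycentric (simplex_boundary n)"
proof -
  let ?\<mu> = "Min (x ` {..Suc n})"
  let ?S = "\<Sum>k\<le>Suc n. x k - ?\<mu>"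
  note \<mu> = sphere_minus_Min[OF x]
  have val: "sphere_to_boundary n x (Suc k) = (x k - ?\<mu>) / ?S" if "k \<le> Suc n" for k
    using that by (simp add: sphere_to_boundary_def)
  have "?\<mu> \<in> x ` {..Suc n}" by (intro Min_in) auto
  then obtain k where "k \<le> Suc n" "x k = ?\<mu>" by fastforce
  then have "\<exists>k\<le>Suc n. sphere_to_boundary n x (Suc k) = 0"
    using val by (metis cancel_comm_monoid_add_class.diff_cancel div_0)
  moreover have "(\<Sum>k\<le>Suc n. sphere_to_boundary n x (Suc k)) = (\<Sum>k\<le>Suc n. (x k - ?\<mu>) / ?S)"
    using val by (intro sum.cong) auto
  then have "(\<Sum>k\<le>Suc n. sphere_to_boundary n x (Suc k)) = 1"
    using \<mu>(2) unfolding sum_divide_distrib[symmetric] by simp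
  moreover have "0 \<le> sphere_to_boundary n x i" for i
    using \<mu>(1)[of "i - 1"] \<mu>(2) unfolding sphere_to_boundary_def
    by (auto intro!: divide_nonneg_pos)
  ultimately show ?thesis
    unfolding barycentric_simplex_boundary by (simp add: sphere_to_boundary_def)
qed

lemma boundary_sphere_boundary:
  assumes "t \<in> barycentric (simplex_boundary n)"
  shows "sphere_to_boundary n (boundary_to_sphere n t) = t"
proof -
  note t = assms[unfolded barycentric_simplex_boundary]
  let ?y = "\<lambda>i. if i \<le> n then t (Suc i) - t (n + 2) else 0"
  define r where "r = sqrt (\<Sum>k\<le>n. (?y k)\<^sup>2)"
  have r: "0 < r"
    using sum_squares_pos[OF simplex_difference_nonzero[OF assms]] by (simp add: r_def)
  define x where "x = boundary_to_sphere n t"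
  have x: "x k = (t (Suc k) - t (n + 2)) / r" if "k \<le> Suc n" for k
    using that by (cases "k = Suc n") (auto simp: x_def boundary_to_sphere_def normalise_def r_def)
  \<comment> \<open>The minimum is attained at a vertex where \<open>t\<close> vanishes.\<close>
  have \<mu>: "Min (x ` {..Suc n}) = - t (n + 2) / r"
  proof (rule Min_eqI)
    fix y assume "y \<in> x ` {..Suc n}"
    then show "- t (n + 2) / r \<le> y"
      using t r by (auto simp: x divide_simps simp del: atMost_Suc)
  next
    obtain k where "k \<le> Suc n" "t (Suc k) = 0" using t by blast
    then show "- t (n + 2) / r \<in> x ` {..Suc n}"
      using x[of k] by force
  qed simp
  have diff: "x k - Min (x ` {..Suc n}) = t (Suc k) / r" if "k \<le> Suc n" for k
    using x[OF that] unfolding \<mu> by (simp add: diff_divide_distrib)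
  then have "(\<Sum>k\<le>Suc n. x k - Min (x ` {..Suc n})) = (\<Sum>k\<le>Suc n. t (Suc k) / r)"
    by (intro sum.cong) auto
  also have "\<dots> = 1 / r"
    using t unfolding sum_divide_distrib[symmetric] by simp
  finally have S: "(\<Sum>k\<le>Suc n. x k - Min (x ` {..Suc n})) = 1 / r" .
  have "sphere_to_boundary n x i = t i" for i
  proof (cases "i \<in> {1..n + 2}")
    case True
    then have "i - 1 \<le> Suc n" "Suc (i - 1) = i" by auto
    then have "sphere_to_boundary n x i = (t i / r) / (1 / r)"
      using True diff[of "i - 1"] unfolding sphere_to_boundary_def S by simp
    then show ?thesis using r by simp
  next
    case False
    then show ?thesis using t sphere_to_boundary_off[OF False] by simp
  qed
  then show ?thesis unfolding x_def by blast
qed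

lemma sphere_boundary_sphere:
  assumes "x \<in> sphere_points n"
  shows "boundary_to_sphere n (sphere_to_boundary n x) = x"
proof -
  define \<mu> where "\<mu> = Min (x ` {..Suc n})"
  define S where "S = (\<Sum>k\<le>Suc n. x k - \<mu>)"
  have S: "0 < S" using sphere_minus_Min(2)[OF assms] by (simp add: S_def \<mu>_def)
  have off: "x i = 0" if "n < i" for i using assms that by (simp add: sphere_points_def)
  have val: "sphere_to_boundary n x (Suc k) = (x k - \<mu>) / S" if "k \<le> Suc n" for k
    using that by (simp add: sphere_to_boundary_def S_def \<mu>_def)
  have y: "(\<lambda>i. if i \<le> n then sphere_to_boundary n x (Suc i) - sphere_to_boundary n x (n + 2) else 0)
      = (\<lambda>i. x i / S)"
  proof
    fix i
    show "(if i \<le> n then sphere_to_boundary n x (Suc i) - sphere_to_boundary n x (n + 2) else 0) = x i / S"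
      using val[of i] val[of "Suc n"] off[of i] off[of "Suc n"] by (auto simp: diff_divide_distrib)
  qed
  have "(\<Sum>k\<le>n. (x k / S)\<^sup>2) = 1 / S\<^sup>2"
    using assms by (simp add: sphere_points_def power_divide flip: sum_divide_distrib)
  then have "sqrt (\<Sum>k\<le>n. (x k / S)\<^sup>2) = 1 / S"
    using S by (simp add: real_sqrt_divide)
  then show ?thesis
    unfolding boundary_to_sphere_def y normalise_def using S by auto
qed

lemma simplex_boundary_homeomorphic_sphere:
  "geometric_realization (simplex_boundary n) homeomorphic_space nsphere n"
proof -
  have "continuous_on (barycentric (simplex_boundary n)) (boundary_to_sphere n)"
  proof -
    have "continuous_on A (\<lambda>t. if i \<le> n then t (Suc i) - t (n + 2) else 0)"
      for i and A :: "(nat \<Rightarrow> real) set"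
      by (cases "i \<le> n") (auto intro!: continuous_intros)
    then have "continuous_on A (\<lambda>t i. if i \<le> n then t (Suc i) - t (n + 2) else 0)"
      for A :: "(nat \<Rightarrow> real) set"
      by (rule continuous_on_coordinatewise_then_product)
    then show ?thesis
      unfolding boundary_to_sphere_def
      by (rule continuous_on_normalise) (rule simplex_difference_nonzero)
  qed
  moreover have "boundary_to_sphere n t \<in> sphere_points n"
    if "t \<in> barycentric (simplex_boundary n)" for t
    unfolding boundary_to_sphere_def
    using that by (intro normalise_in_sphere simplex_difference_nonzero)
  moreover have "continuous_on (sphere_points n) (sphere_to_boundary n)"
  proof (rule continuous_on_coordinatewise_then_product)
    fix i
    have Min: "continuous_on (sphere_points n) (\<lambda>x. Min (x ` {..Suc n}))"
      by (rule continuous_on_Min) (auto intro: continuous_intros)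
    show "continuous_on (sphere_points n) (\<lambda>x. sphere_to_boundary n x i)"
    proof (cases "i \<in> {1..n + 2}")
      case True
      then have "continuous_on (sphere_points n) (\<lambda>x. sphere_to_boundary n x i) \<longleftrightarrow>
          continuous_on (sphere_points n) (\<lambda>x. (x (i - 1) - Min (x ` {..Suc n})) /
             (\<Sum>k\<le>Suc n. x k - Min (x ` {..Suc n})))"
        unfolding sphere_to_boundary_def by simp
      also have "\<dots>"
        using sphere_minus_Min(2)
        by (intro continuous_on_divide continuous_on_diff continuous_on_sum Min continuous_on_coordinate)
          fastforce
      finally show ?thesis .
    next
      case False
      then show ?thesis by (simp only: sphere_to_boundary_off[OF False] continuous_on_const)
    qed
  qed
  ultimately show ?thesis
    unfolding homeomorphic_space_def homeomorphic_maps_def geometric_realization_eq nsphere_eq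
    using sphere_to_boundary_in boundary_sphere_boundary sphere_boundary_sphere
    by (intro exI[of _ "boundary_to_sphere n"] exI[of _ "sphere_to_boundary n"]) auto
qed

section \<open>Maps from a sphere to a sphere of higher dimension\<close>

text \<open>
  Fewer homogeneous linear equations than unknowns have a nontrivial solution. The proof is
  Gaussian elimination: use one equation to eliminate an unknown \<open>k\<close> from the others.
\<close>

lemma ex_annihilator:
  fixes u :: "'l \<Rightarrow> 'i \<Rightarrow> real"
  assumes "finite A" "finite I" "card A < card I"
  shows "\<exists>c. (\<exists>i\<in>I. c i \<noteq> 0) \<and> (\<forall>a\<in>A. (\<Sum>i\<in>I. c i * u a i) = 0)"
  using assms
proof (induction A arbitrary: I u rule: finite_induct)
  case empty
  then have "I \<noteq> {}" by auto
  then show ?case by (intro exI[of _ "\<lambda>_. 1"]) auto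
next
  case (insert a A)
  show ?case
  proof (cases "\<forall>i\<in>I. u a i = 0")
    case True
    then show ?thesis
      using insert.IH[OF insert.prems(1), of u] insert by auto
  next
    case False
    then obtain k where k: "k \<in> I" "u a k \<noteq> 0" by blast
    let ?I = "I - {k}"
    let ?u = "\<lambda>b i. u b i - u b k / u a k * u a i"
    have "finite ?I" "card A < card ?I"
      using insert k by auto
    from insert.IH[OF this, of ?u] obtain c
      where c: "\<exists>i\<in>?I. c i \<noteq> 0" "\<And>b. b \<in> A \<Longrightarrow> (\<Sum>i\<in>?I. c i * ?u b i) = 0" by blast
    define s where "s = (\<Sum>i\<in>?I. c i * u a i) / u a k"
    define d where "d = c(k := - s)"
    have d: "(\<Sum>i\<in>I. d i * u b i) = (\<Sum>i\<in>?I. c i * u b i) - s * u b k" for b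
      using k(1) insert.prems(1) by (simp add: sum.remove[of I k] d_def)
    have "(\<Sum>i\<in>I. d i * u b i) = 0" if "b \<in> insert a A" for b
    proof (cases "b = a")
      case True
      then show ?thesis using k(2) by (simp add: d s_def)
    next
      case False
      then have "0 = (\<Sum>i\<in>?I. c i * u b i - u b k / u a k * (c i * u a i))"
        using c(2)[of b] that by (simp add: algebra_simps)
      also have "\<dots> = (\<Sum>i\<in>?I. c i * u b i) - u b k / u a k * (\<Sum>i\<in>?I. c i * u a i)"
        by (simp only: sum_subtractf sum_distrib_left)
      finally show ?thesis by (simp add: d s_def)
    qed
    moreover have "\<exists>i\<in>I. d i \<noteq> 0" using c(1) by (auto simp: d_def)
    ultimately show ?thesis by blast
  qed
qed

text \<open>
  The affine span of at most \<open>n + 1\<close> points of an \<open>(n+1)\<close>-dimensional space is a proper subspace,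
  and finitely many of them miss some point \<open>p\<close> close to the origin. Such a point exists on the
  moment curve \<open>\<tau> \<mapsto> (\<tau>, \<tau>\<^sup>2, \<dots>)\<close>: each subspace lies in the zero set of a nonzero affine
  function, whose restriction to the curve is a nonzero polynomial in \<open>\<tau>\<close> with finitely many roots.
  The conclusion says that \<open>p\<close> is no affine combination of the points \<open>w a\<close> with \<open>a\<close> in \<open>A\<close>.
\<close>

lemma ex_small_generic_point:
  fixes w :: "'l \<Rightarrow> nat \<Rightarrow> real"
  assumes "finite L" "0 < \<epsilon>"
  shows "\<exists>p. (\<forall>i>n. p i = 0) \<and> (\<forall>i. \<bar>p i\<bar> \<le> \<epsilon>) \<and>
    (\<forall>A \<kappa>. A \<subseteq> L \<longrightarrow> card A \<le> Suc n \<longrightarrow> 0 < sum \<kappa> A \<longrightarrow>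
       (\<exists>i\<le>n. (\<Sum>a\<in>A. \<kappa> a * (w a i - p i)) \<noteq> 0))"
proof -
  \<comment> \<open>Homogeneous coordinates: an affine function becomes a linear one in \<open>n + 2\<close> unknowns.\<close>
  define u where "u a i = (case i of 0 \<Rightarrow> 1 | Suc k \<Rightarrow> w a k)" for a i
  have "\<exists>c. (\<exists>i\<in>{..Suc n}. c i \<noteq> 0) \<and> (\<forall>a\<in>A. (\<Sum>i\<le>Suc n. c i * u a i) = 0)"
    if "A \<subseteq> L" "card A \<le> Suc n" for A
    using that assms(1) by (intro ex_annihilator) (auto intro: finite_subset)
  then obtain c where c: "\<And>A. A \<subseteq> L \<Longrightarrow> card A \<le> Suc n \<Longrightarrow> \<exists>i\<le>Suc n. c A i \<noteq> 0"
      "\<And>A a. A \<subseteq> L \<Longrightarrow> card A \<le> Suc n \<Longrightarrow> a \<in> A \<Longrightarrow> (\<Sum>i\<le>Suc n. c A i * u a i) = 0"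
    by (metis atMost_iff)
  define R where "R = (\<Union>A\<in>{A. A \<subseteq> L \<and> card A \<le> Suc n}. {\<tau>. (\<Sum>i\<le>Suc n. c A i * \<tau> ^ i) = 0})"
  have "finite R"
    unfolding R_def using c(1) assms(1)
    by (auto simp: polyfun_finite_roots simp del: sum.atMost_Suc)
  moreover have "infinite {0<..<min 1 \<epsilon>}"
    using assms(2) by (intro infinite_Ioo) auto
  ultimately have "\<not> {0<..<min 1 \<epsilon>} \<subseteq> R"
    using finite_subset by blast
  then obtain \<tau> where "\<tau> \<in> {0<..<min 1 \<epsilon>}" "\<tau> \<notin> R"
    by blast
  then have \<tau>: "0 < \<tau>" "\<tau> < 1" "\<tau> < \<epsilon>" "\<tau> \<notin> R"
    by auto
  define p where "p i = (if i \<le> n then \<tau> ^ Suc i else 0)" for i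
  have "\<bar>p i\<bar> \<le> \<epsilon>" for i
  proof -
    have "\<tau> ^ Suc i \<le> \<tau> * 1"
      unfolding power_Suc using \<tau> by (intro mult_left_mono power_le_one) auto
    then show ?thesis using \<tau> assms(2) by (simp add: p_def del: power_Suc)
  qed
  moreover have "\<exists>i\<le>n. (\<Sum>a\<in>A. \<kappa> a * (w a i - p i)) \<noteq> 0"
    if A: "A \<subseteq> L" "card A \<le> Suc n" and pos: "0 < sum \<kappa> A" for A \<kappa>
  proof (rule ccontr)
    assume "\<not> ?thesis"
    then have w: "(\<Sum>a\<in>A. \<kappa> a * w a i) = sum \<kappa> A * \<tau> ^ Suc i" if "i \<le> n" for i
      using that by (simp add: p_def right_diff_distrib sum_subtractf sum_distrib_right)
    have "0 = (\<Sum>a\<in>A. \<kappa> a * (\<Sum>i\<le>Suc n. c A i * u a i))"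
      using c(2)[OF A] by simp
    also have "\<dots> = (\<Sum>i\<le>Suc n. c A i * (\<Sum>a\<in>A. \<kappa> a * u a i))"
      unfolding sum_distrib_left by (subst sum.swap) (simp add: mult_ac)
    also have "\<dots> = (\<Sum>i\<le>Suc n. c A i * (sum \<kappa> A * \<tau> ^ i))"
    proof (intro sum.cong refl)
      fix i assume "i \<in> {..Suc n}"
      then have "(\<Sum>a\<in>A. \<kappa> a * u a i) = sum \<kappa> A * \<tau> ^ i"
        using w by (cases i) (auto simp: u_def)
      then show "c A i * (\<Sum>a\<in>A. \<kappa> a * u a i) = c A i * (sum \<kappa> A * \<tau> ^ i)" by simp
    qed
    also have "\<dots> = sum \<kappa> A * (\<Sum>i\<le>Suc n. c A i * \<tau> ^ i)"
      by (simp add: sum_distrib_left mult_ac del: sum.atMost_Suc)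
    finally have "(\<Sum>i\<le>Suc n. c A i * \<tau> ^ i) = 0"
      using pos by simp
    then show False
      using \<tau>(4) A by (auto simp: R_def)
  qed
  ultimately show ?thesis
    by (intro exI[of _ p]) (auto simp: p_def)
qed

text \<open>
  A bump around the lattice point \<open>v\<close>. Coordinate \<open>d\<close> is to be thought of as \<open>0\<close> in both \<open>x\<close> and
  \<open>v\<close>, so that the bump lives on a space of dimension \<open>d\<close>. It is positive exactly where all
  coordinates of \<open>x - v\<close>, including this one, lie within a window of length less than \<open>1\<close>; these
  are the open stars of the vertices in the Freudenthal triangulation of the space.
\<close>

definition hat :: "nat \<Rightarrow> (nat \<Rightarrow> int) \<Rightarrow> (nat \<Rightarrow> real) \<Rightarrow> real" where
  "hat d v x = (\<Prod>i\<le>d. \<Prod>k\<le>d. max 0 (1 - \<bar>(x i - v i) - (x k - v k)\<bar>))"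

lemma hat_nonneg: "0 \<le> hat d v x"
  by (simp add: hat_def prod_nonneg)

lemma hat_pos_iff:
  "0 < hat d v x \<longleftrightarrow> (\<forall>i\<le>d. \<forall>k\<le>d. \<bar>(x i - v i) - (x k - v k)\<bar> < 1)"
proof
  assume "0 < hat d v x"
  then have "\<forall>i\<le>d. \<forall>k\<le>d. max 0 (1 - \<bar>(x i - v i) - (x k - v k)\<bar>) \<noteq> 0"
    unfolding hat_def by (auto simp: less_le)
  then show "\<forall>i\<le>d. \<forall>k\<le>d. \<bar>(x i - v i) - (x k - v k)\<bar> < 1"
    by (fastforce simp: max_def split: if_splits)
next
  assume "\<forall>i\<le>d. \<forall>k\<le>d. \<bar>(x i - v i) - (x k - v k)\<bar> < 1"
  then show "0 < hat d v x"
    unfolding hat_def by (intro prod_pos) auto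
qed

text \<open>
  A point lies in at most \<open>d + 1\<close> open stars, as a simplex of dimension \<open>d\<close> has \<open>d + 1\<close> vertices.
  Indeed, \<open>v\<close> is determined by \<open>x\<close> and a position \<open>i\<close> where \<open>x - v\<close> is smallest. The minimum lies
  in the half-open interval from \<open>-1\<close> to \<open>0\<close>, because coordinate \<open>d\<close> contributes \<open>0\<close>, and this
  determines the integer \<open>v i\<close>. All other coordinates of \<open>x - v\<close> lie less than \<open>1\<close> above the
  minimum, which determines the rest of \<open>v\<close>.
\<close>

lemma card_active_le:
  assumes L: "finite L" "\<And>v i. v \<in> L \<Longrightarrow> d \<le> i \<Longrightarrow> v i = 0" and x: "x d = 0"
  shows "card {v\<in>L. 0 < hat d v x} \<le> Suc d"
proof -
  define A where "A = {v\<in>L. 0 < hat d v x}"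
  have "\<exists>i\<le>d. \<forall>k\<le>d. x i - v i \<le> x k - v k" for v :: "nat \<Rightarrow> int"
  proof -
    obtain i where "is_arg_min (\<lambda>i. x i - v i) (\<lambda>i. i \<in> {..d}) i"
      using ex_is_arg_min_if_finite[of "{..d}" "\<lambda>i. x i - v i"] by auto
    then show ?thesis by (auto simp: is_arg_min_linorder)
  qed
  then have "\<forall>v :: nat \<Rightarrow> int. \<exists>i. i \<le> d \<and> (\<forall>k\<le>d. x i - v i \<le> x k - v k)" by blast
  from choice[OF this] obtain \<mu> :: "(nat \<Rightarrow> int) \<Rightarrow> nat"
    where \<mu>: "\<And>v. \<mu> v \<le> d" "\<And>v k. k \<le> d \<Longrightarrow> x (\<mu> v) - v (\<mu> v) \<le> x k - v k"
    by blast
  have "inj_on \<mu> A"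
  proof (rule inj_onI)
    fix v v' assume v: "v \<in> A" and v': "v' \<in> A" and eq: "\<mu> v = \<mu> v'"
    let ?i = "\<mu> v"
    have min: "x ?i - w ?i \<le> x k - w k" if "w \<in> {v, v'}" "k \<le> d" for w k
      using that \<mu>(2)[of k v] \<mu>(2)[of k v'] eq by auto
    have "\<bar>(x k - w k) - (x ?i - w ?i)\<bar> < 1" if "w \<in> {v, v'}" "k \<le> d" for w k
      using that v v' \<mu>(1)[of v] by (auto simp: A_def hat_pos_iff)
    then have near: "x ?i - w ?i \<le> x k - w k" "x k - w k < x ?i - w ?i + 1"
      if "w \<in> {v, v'}" "k \<le> d" for w k
      using min[OF that] that by fastforce+
    have "v d = 0" "v' d = 0" using v v' L by (auto simp: A_def)
    then have "v ?i = v' ?i"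
      using near[of v d] near[of v' d] x by simp
    then have "v k = v' k" if "k \<le> d" for k
      using near[of v k] near[of v' k] that by simp
    moreover have "v k = v' k" if "\<not> k \<le> d" for k
      using that v v' L(2)[of v k] L(2)[of v' k] by (simp add: A_def)
    ultimately show "v = v'" by blast
  qed
  moreover have "\<mu> ` A \<subseteq> {..d}" using \<mu>(1) by auto
  ultimately have "card A \<le> card {..d}" by (intro card_inj_on_le) auto
  then show ?thesis by (simp add: A_def)
qed

lemma sphere_coordinate_le:
  assumes "x \<in> sphere_points n"
  shows "\<bar>x i\<bar> \<le> 1"
proof (cases "i \<le> n")
  case True
  then have "(x i)\<^sup>2 \<le> 1"
    using member_le_sum[of i "{..n}" "\<lambda>i. (x i)\<^sup>2"] assms by (simp add: sphere_points_def)
  then show ?thesis by (simp add: abs_square_le_1)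
next
  case False
  then show ?thesis using assms by (simp add: sphere_points_def)
qed

lemma compact_sphere_points: "compact (sphere_points n)"
proof -
  have "closed {x :: nat \<Rightarrow> real. (\<Sum>i\<le>n. (x i)\<^sup>2) = 1}"
    by (intro closed_Collect_eq continuous_intros)
  moreover have "closed (\<Inter>i\<in>{n<..}. {x :: nat \<Rightarrow> real. x i = 0})"
    by (intro closed_INT ballI closed_Collect_eq continuous_intros)
  moreover have "sphere_points n =
      {x. (\<Sum>i\<le>n. (x i)\<^sup>2) = 1} \<inter> (\<Inter>i\<in>{n<..}. {x. x i = 0})"
    by (auto simp: sphere_points_def)
  ultimately have "closed (sphere_points n)"
    by (simp add: closed_Int)
  moreover have "sphere_points n \<subseteq> UNIV \<rightarrow>\<^sub>E {-1..1}"
    using sphere_coordinate_le by (auto simp: abs_le_iff minus_le_iff)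
  moreover have "compactin (powertop_real UNIV) (UNIV \<rightarrow>\<^sub>E {-1..1 :: real})"
    by (simp add: compactin_PiE)
  ultimately have "compactin (powertop_real UNIV) (sphere_points n)"
    unfolding euclidean_product_topology by (metis closed_closedin closed_compactin)
  then show ?thesis
    by (simp add: euclidean_product_topology)
qed

lemma dist_function_less:
  assumes "0 < e"
  shows "\<exists>d>0. \<forall>x y :: nat \<Rightarrow> real. (\<forall>i. \<bar>x i - y i\<bar> \<le> d) \<longrightarrow> dist x y < e"
proof -
  obtain M where M: "(1 / 2 :: real) ^ M < e / 2"
    using real_arch_pow_inv[of "e / 2" "1 / 2"] assms by auto
  have "dist x y < e" if "\<forall>i. \<bar>x i - y i\<bar> \<le> e / 8" for x y :: "nat \<Rightarrow> real"
  proof -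
    let ?D = "{dist (x (from_nat n)) (y (from_nat n)) |n. n \<le> M}"
    have eq: "?D = (\<lambda>n. dist (x (from_nat n)) (y (from_nat n))) ` {..M}"
      by auto
    have "Max ?D \<le> e / 8"
    proof (rule Max.boundedI)
      show "finite ?D" unfolding eq by simp
      show "?D \<noteq> {}" unfolding eq by simp
      show "a \<le> e / 8" if "a \<in> ?D" for a
        using that \<open>\<forall>i. \<bar>x i - y i\<bar> \<le> e / 8\<close> by (auto simp: dist_real_def)
    qed
    then show ?thesis
      using dist_fun_le_dist_first_terms[of x y M] M assms by linarith
  qed
  then show ?thesis
    using assms by (intro exI[of _ "e / 8"]) auto
qed

text \<open>
  Uniform continuity of \<open>f\<close>, in the form in which it is used: values at nearby points have an inner
  product bounded away from \<open>0\<close>.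
\<close>

lemma sphere_map_modulus:
  assumes f: "continuous_on (sphere_points j) f" "f \<in> sphere_points j \<rightarrow> sphere_points n"
  shows "\<exists>d>0. \<forall>x\<in>sphere_points j. \<forall>y\<in>sphere_points j. (\<forall>i. \<bar>x i - y i\<bar> \<le> d) \<longrightarrow>
           1 / 2 < (\<Sum>i\<le>n. f x i * f y i)"
proof -
  let ?S = "sphere_points j"
  let ?q = "\<lambda>p. \<Sum>i\<le>n. f (fst p) i * f (snd p) i"
  have "continuous_on (?S \<times> ?S) (\<lambda>p. f (fst p))"
    by (rule continuous_on_compose2[OF f(1) continuous_on_fst[OF continuous_on_id]]) auto
  moreover have "continuous_on (?S \<times> ?S) (\<lambda>p. f (snd p))"
    by (rule continuous_on_compose2[OF f(1) continuous_on_snd[OF continuous_on_id]]) auto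
  ultimately have "continuous_on (?S \<times> ?S) ?q"
    by (intro continuous_on_sum continuous_on_mult) (auto dest: continuous_on_product_then_coordinatewise)
  then have "uniformly_continuous_on (?S \<times> ?S) ?q"
    by (intro compact_uniformly_continuous compact_Times compact_sphere_points)
  from this[unfolded uniformly_continuous_on_def, THEN spec, of "1 / 2"] obtain e where e: "0 < e"
      "\<And>p p'. p \<in> ?S \<times> ?S \<Longrightarrow> p' \<in> ?S \<times> ?S \<Longrightarrow> dist p' p < e \<Longrightarrow> dist (?q p') (?q p) < 1 / 2"
    by fastforce
  obtain d where d: "0 < d" "\<And>x y :: nat \<Rightarrow> real. \<forall>i. \<bar>x i - y i\<bar> \<le> d \<Longrightarrow> dist x y < e"
    using dist_function_less[OF e(1)] by blast
  have "1 / 2 < (\<Sum>i\<le>n. f x i * f y i)"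
    if xy: "x \<in> ?S" "y \<in> ?S" "\<forall>i. \<bar>x i - y i\<bar> \<le> d" for x y
  proof -
    have "(\<Sum>i\<le>n. f x i * f x i) = 1"
      using f(2) xy(1) by (force simp: sphere_points_def power2_eq_square)
    moreover have "dist (x, x) (x, y) < e"
      using d(2)[OF xy(3)] by (simp add: dist_Pair_Pair)
    ultimately have "\<bar>1 - (\<Sum>i\<le>n. f x i * f y i)\<bar> < 1 / 2"
      using e(2)[of "(x, y)" "(x, x)"] xy by (simp add: dist_real_def)
    then show ?thesis by linarith
  qed
  then show ?thesis using d(1) by blast
qed

text \<open>
  The map \<open>G\<close> in the proof is the translated blend of values of \<open>f\<close>. It does not vanish on the
  ball, by the choice of \<open>p\<close>, and on the sphere its inner product with \<open>f\<close> is positive. So the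
  segment from \<open>f x\<close> to \<open>G x\<close> avoids the origin, and \<open>f\<close> is homotopic to the normalised \<open>G\<close>, which
  extends to the ball.
\<close>

lemma nullhomotopic_low_dimensional_sphere_map:
  assumes "j < n" and f: "continuous_map (nsphere j) (nsphere n) f"
  shows "\<exists>c. homotopic_with (\<lambda>_. True) (nsphere j) (nsphere n) f (\<lambda>_. c)"
proof -
  let ?S = "sphere_points j"
  have cf: "continuous_on ?S f" and fS: "f \<in> ?S \<rightarrow> sphere_points n"
    using f by (auto simp: nsphere_eq)
  obtain d where d: "0 < d" "\<And>x y. x \<in> ?S \<Longrightarrow> y \<in> ?S \<Longrightarrow> \<forall>i. \<bar>x i - y i\<bar> \<le> d \<Longrightarrow>
      1 / 2 < (\<Sum>i\<le>n. f x i * f y i)"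
    using sphere_map_modulus[OF cf fS] by blast
  \<comment> \<open>The lattice has mesh \<open>1 / N\<close>; two points in the same open star are closer than \<open>2 / N\<close>.\<close>
  obtain N :: nat where N: "2 / d < N"
    using reals_Archimedean2 by blast
  have N0: "0 < real N"
    using N d(1) by (smt (verit) divide_pos_pos)
  define L :: "(nat \<Rightarrow> int) set" where
    "L = {v. \<forall>i. (i \<in> {..j} \<longrightarrow> v i \<in> {- int N..int N}) \<and> (i \<notin> {..j} \<longrightarrow> v i = 0)}"
  have finL: "finite L"
    unfolding L_def by (rule finite_set_of_finite_funs) auto
  have L0: "v i = 0" if "v \<in> L" "Suc j \<le> i" for v i
    using that by (simp add: L_def)
  define H where "H v x = hat (Suc j) v (\<lambda>i. N * x i)" for v and x :: "nat \<Rightarrow> real"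
  have H0: "0 \<le> H v x" for v x
    by (simp add: H_def hat_nonneg)
  have close: "\<forall>i. \<bar>x i - y i\<bar> \<le> d"
    if "x \<in> ?S" "y \<in> ?S" "v \<in> L" "0 < H v x" "0 < H v y" for x y v
  proof
    fix i
    have near: "\<bar>N * z i - v i\<bar> < 1" if "z \<in> ?S" "0 < H v z" "i \<le> j" for z :: "nat \<Rightarrow> real"
    proof -
      have "\<bar>(N * z i - v i) - (N * z (Suc j) - v (Suc j))\<bar> < 1"
        using that(2,3) unfolding H_def hat_pos_iff by simp
      then show ?thesis
        using that(1) L0[OF \<open>v \<in> L\<close>, of "Suc j"] by (simp add: sphere_points_def)
    qed
    show "\<bar>x i - y i\<bar> \<le> d"
    proof (cases "i \<le> j")
      case True
      have "N * \<bar>x i - y i\<bar> = \<bar>N * x i - N * y i\<bar>"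
        using N0 by (simp add: abs_mult flip: right_diff_distrib)
      also have "\<dots> < 2"
        using near[of x] near[of y] that True by linarith
      also have "\<dots> < N * d"
        using N d(1) by (simp add: field_simps)
      finally show ?thesis
        using N0 by (simp add: mult_less_cancel_left_pos)
    next
      case False
      then show ?thesis
        using that(1,2) d(1) by (simp add: sphere_points_def)
    qed
  qed
  \<comment> \<open>The value of \<open>f\<close> somewhere in the open star of \<open>v\<close>; stars that miss the sphere get the value \<open>0\<close>.\<close>
  define w where "w v = (if \<exists>y\<in>?S. 0 < H v y then f (SOME y. y \<in> ?S \<and> 0 < H v y) else (\<lambda>_. 0))" for v
  have fw: "1 / 2 < (\<Sum>i\<le>n. f x i * w v i)" if "x \<in> ?S" "v \<in> L" "0 < H v x" for x v
  proof -
    have ex: "\<exists>y. y \<in> ?S \<and> 0 < H v y" using that by blast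
    define y where "y = (SOME y. y \<in> ?S \<and> 0 < H v y)"
    have "y \<in> ?S" "0 < H v y"
      using someI_ex[OF ex] by (auto simp: y_def)
    moreover have "w v = f y"
      using ex by (auto simp: w_def y_def)
    ultimately show ?thesis
      using d(2)[of x y] close[of x y v] that by simp
  qed
  have w_off: "w v i = 0" if "n < i" for v i
  proof (cases "\<exists>y. y \<in> ?S \<and> 0 < H v y")
    case True
    from someI_ex[OF this] have "f (SOME y. y \<in> ?S \<and> 0 < H v y) \<in> sphere_points n"
      using fS by blast
    then show ?thesis
      using True that by (auto simp: w_def sphere_points_def)
  next
    case False
    then show ?thesis by (auto simp: w_def)
  qed
  \<comment> \<open>With this bound the inner product of \<open>p\<close> and a unit vector is at most \<open>1 / 2\<close>.\<close>
  have "0 < 1 / (2 * real (Suc n))" by simp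
  from ex_small_generic_point[OF finL this, of n w] obtain p
    where p_off: "\<forall>i>n. p i = 0" and p_le: "\<forall>i. \<bar>p i\<bar> \<le> 1 / (2 * real (Suc n))"
      and generic: "\<forall>A \<kappa>. A \<subseteq> L \<longrightarrow> card A \<le> Suc n \<longrightarrow> 0 < sum \<kappa> A \<longrightarrow>
         (\<exists>i\<le>n. (\<Sum>v\<in>A. \<kappa> v * (w v i - p i)) \<noteq> 0)"
    by blast
  define G where "G x i = (\<Sum>v\<in>L. H v x * (w v i - p i))" for x i
  have ex_active: "\<exists>v\<in>L. 0 < H v x" if x: "x \<in> ball_points j" for x
  proof
    \<comment> \<open>Rounding down gives a lattice point whose star contains \<open>x\<close>.\<close>
    define u where "u i = \<lfloor>N * x i\<rfloor>" for i
    have frac: "0 \<le> N * x i - u i" "N * x i - u i < 1" for i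
      unfolding u_def using of_int_floor_le[of "N * x i"] real_of_int_floor_add_one_gt[of "N * x i"]
      by linarith+
    show "0 < H u x"
      unfolding H_def hat_pos_iff
    proof (intro allI impI)
      fix i k
      show "\<bar>(N * x i - u i) - (N * x k - u k)\<bar> < 1"
        using frac[of i] frac[of k] by linarith
    qed
    have "u i \<in> {- int N..int N}" if "i \<le> j" for i
    proof -
      have "(x i)\<^sup>2 \<le> 1"
        using member_le_sum[of i "{..j}" "\<lambda>i. (x i)\<^sup>2"] that x by (simp add: ball_points_def)
      then have "\<bar>x i\<bar> \<le> 1" by (simp add: abs_square_le_1)
      then have "real N * (- 1) \<le> N * x i" "N * x i \<le> real N * 1"
        using N0 by (intro mult_left_mono; linarith)+
      then show ?thesis
        unfolding u_def by (simp add: le_floor_iff floor_le_iff)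
    qed
    moreover have "u i = 0" if "j < i" for i
      using that x by (simp add: u_def ball_points_def)
    ultimately show "u \<in> L" by (simp add: L_def)
  qed
  have sumH: "0 < (\<Sum>v\<in>L. H v x)" if "x \<in> ball_points j" for x
    using ex_active[OF that] H0 finL by (meson sum_pos2)
  have G_nz: "G x \<in> nonzero_points n" if x: "x \<in> ball_points j" for x
  proof -
    define A where "A = {v\<in>L. 0 < H v x}"
    have AL: "A \<subseteq> L" "finite A" using finL by (auto simp: A_def)
    have "card A \<le> Suc (Suc j)"
      unfolding A_def H_def using x
      by (intro card_active_le finL L0) (auto simp: ball_points_def)
    then have "card A \<le> Suc n" using assms(1) by simp
    moreover have off: "H v x = 0" if "v \<in> L - A" for v
      using that H0[of v x] by (auto simp: A_def)
    then have restrict: "(\<Sum>v\<in>A. H v x * g v) = (\<Sum>v\<in>L. H v x * g v)" for g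
      using AL finL by (intro sum.mono_neutral_left) auto
    have "0 < (\<Sum>v\<in>A. H v x)"
      using sumH[OF x] restrict[of "\<lambda>_. 1"] by simp
    ultimately obtain i where "i \<le> n" "(\<Sum>v\<in>A. H v x * (w v i - p i)) \<noteq> 0"
      using generic AL(1) by blast
    then have "i \<le> n" "G x i \<noteq> 0" by (simp_all add: G_def restrict)
    moreover have "G x i = 0" if "n < i" for i
      using that by (simp add: G_def w_off p_off)
    ultimately show ?thesis by (auto simp: nonzero_points_def)
  qed
  have G_pos: "0 < (\<Sum>i\<le>n. f x i * G x i)" if x: "x \<in> ?S" for x
  proof -
    have fx: "\<bar>f x i\<bar> \<le> 1" for i
      using fS x by (auto intro: sphere_coordinate_le)
    have "(\<Sum>i\<le>n. f x i * p i) \<le> (\<Sum>i\<le>n. 1 / (2 * real (Suc n)))"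
    proof (rule sum_mono)
      fix i
      have "f x i * p i \<le> \<bar>f x i\<bar> * \<bar>p i\<bar>"
        by (simp flip: abs_mult)
      also have "\<dots> \<le> 1 * (1 / (2 * real (Suc n)))"
        using fx p_le by (intro mult_mono) auto
      finally show "f x i * p i \<le> 1 / (2 * real (Suc n))" by simp
    qed
    also have "\<dots> = 1 / 2" by (simp add: field_simps)
    finally have fp: "(\<Sum>i\<le>n. f x i * p i) \<le> 1 / 2" .
    have "(\<Sum>i\<le>n. f x i * G x i) = (\<Sum>v\<in>L. \<Sum>i\<le>n. H v x * (f x i * w v i - f x i * p i))"
      unfolding G_def sum_distrib_left by (subst sum.swap) (simp add: algebra_simps)
    also have "\<dots> = (\<Sum>v\<in>L. H v x * ((\<Sum>i\<le>n. f x i * w v i) - (\<Sum>i\<le>n. f x i * p i)))"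
      by (simp add: sum_subtractf flip: sum_distrib_left)
    finally have eq: "(\<Sum>i\<le>n. f x i * G x i) =
        (\<Sum>v\<in>L. H v x * ((\<Sum>i\<le>n. f x i * w v i) - (\<Sum>i\<le>n. f x i * p i)))" .
    have pos: "0 < H v x * ((\<Sum>i\<le>n. f x i * w v i) - (\<Sum>i\<le>n. f x i * p i))"
      if "v \<in> L" "0 < H v x" for v
      using fw[OF x that] fp that(2) by (intro mult_pos_pos) auto
    obtain u where "u \<in> L" "0 < H u x"
      using ex_active x sphere_subset_ball by blast
    moreover have "0 \<le> H v x * ((\<Sum>i\<le>n. f x i * w v i) - (\<Sum>i\<le>n. f x i * p i))" if "v \<in> L" for v
      using pos[OF that] H0[of v x] by (cases "0 < H v x") auto
    ultimately show ?thesis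
      unfolding eq using pos by (intro sum_pos2[OF finL]) auto
  qed
  have cG: "continuous_on A G" for A
    unfolding G_def H_def hat_def by (intro continuous_intros)
  have "continuous_map (nball (Suc j)) (nsphere n) (\<lambda>x. normalise n (G x))"
    unfolding nball_eq nsphere_eq using G_nz
    by (auto intro: continuous_on_normalise[OF cG] normalise_in_sphere)
  from nullhomotopic_if_extends[OF this refl] obtain c
    where c: "homotopic_with (\<lambda>_. True) (nsphere j) (nsphere n) (\<lambda>x. normalise n (G x)) (\<lambda>_. c)" ..
  let ?h = "\<lambda>(t, x) i. (1 - t) * f x i + t * G x i"
  have nz: "?h (t, x) \<in> nonzero_points n" if t: "t \<in> {0..1}" and x: "x \<in> ?S" for t x
  proof -
    have fx: "(\<Sum>i\<le>n. f x i * f x i) = 1" "\<And>i. n < i \<Longrightarrow> f x i = 0"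
      using fS x by (auto simp: sphere_points_def power2_eq_square Pi_iff)
    have "(\<Sum>i\<le>n. f x i * ?h (t, x) i) = (1 - t) * (\<Sum>i\<le>n. f x i * f x i) + t * (\<Sum>i\<le>n. f x i * G x i)"
      unfolding sum_distrib_left sum.distrib[symmetric]
      by (intro sum.cong) (auto simp: algebra_simps)
    moreover have "0 < (1 - t) * (\<Sum>i\<le>n. f x i * f x i) + t * (\<Sum>i\<le>n. f x i * G x i)"
      using t G_pos[OF x] unfolding fx(1)
      by (cases "t = 0") (auto intro: add_nonneg_pos)
    ultimately have "0 < (\<Sum>i\<le>n. f x i * ?h (t, x) i)"
      by simp
    then have "\<exists>i\<in>{..n}. f x i * ?h (t, x) i \<noteq> 0"
      using sum.neutral[of "{..n}" "\<lambda>i. f x i * ?h (t, x) i"] less_irrefl[of "0 :: real"]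
      by fastforce
    moreover have "?h (t, x) i = 0" if "n < i" for i
      using that fx(2) G_nz[OF subsetD[OF sphere_subset_ball x]] by (simp add: nonzero_points_def)
    ultimately show ?thesis by (auto simp: nonzero_points_def)
  qed
  have "continuous_on ({0..1} \<times> ?S) (\<lambda>q. f (snd q))"
    by (rule continuous_on_compose2[OF cf continuous_on_snd[OF continuous_on_id]]) auto
  moreover have "continuous_on ({0..1} \<times> ?S) (\<lambda>q. G (snd q))"
    by (rule continuous_on_compose2[OF cG[of UNIV] continuous_on_snd[OF continuous_on_id]]) auto
  ultimately have "continuous_on ({0..1} \<times> ?S) ?h"
    unfolding case_prod_unfold
    by (intro continuous_on_coordinatewise_then_product continuous_on_add continuous_on_mult
        continuous_on_diff continuous_on_const continuous_on_fst continuous_on_id)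
      (auto dest: continuous_on_product_then_coordinatewise)
  then have "continuous_on ({0..1} \<times> ?S) (\<lambda>q. normalise n (?h q))"
    using nz by (intro continuous_on_normalise) auto
  then have "continuous_map (prod_topology (top_of_set {0..1}) (nsphere j)) (nsphere n) (\<lambda>q. normalise n (?h q))"
    unfolding nsphere_eq using nz normalise_in_sphere by auto
  then have "homotopic_with (\<lambda>_. True) (nsphere j) (nsphere n)
      (\<lambda>x. normalise n (f x)) (\<lambda>x. normalise n (G x))"
    unfolding homotopic_with_def by (intro exI[of _ "\<lambda>q. normalise n (?h q)"]) simp
  then have "homotopic_with (\<lambda>_. True) (nsphere j) (nsphere n) (\<lambda>x. normalise n (f x)) (\<lambda>_. c)"
    using c by (rule homotopic_with_trans)
  then have "homotopic_with (\<lambda>_. True) (nsphere j) (nsphere n) f (\<lambda>_. c)"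
    using fS by (elim homotopic_with_eq) (auto simp: nsphere_eq Pi_iff normalise_sphere)
  then show ?thesis by blast
qed

section \<open>The neighborhood complex of the exponential graph\<close>

text \<open>
  The identity of the \<open>n\<close>-sphere has no extension to the ball, since the sphere is not contractible.
\<close>

lemma k_connected_nsphere: "k_connected k (nsphere n) \<longleftrightarrow> k < int n"
proof
  assume "k < int n"
  then show "k_connected k (nsphere n)"
    unfolding k_connected_iff_nullhomotopic
    by (intro allI impI nullhomotopic_low_dimensional_sphere_map) auto
next
  assume con: "k_connected k (nsphere n)"
  show "k < int n"
  proof (rule ccontr)
    assume "\<not> k < int n"
    then have "\<exists>c. homotopic_with (\<lambda>_. True) (nsphere n) (nsphere n) id (\<lambda>_. c)"
      using con unfolding k_connected_iff_nullhomotopic by simp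
    then show False
      using non_contractible_space_nsphere unfolding contractible_space_def by blast
  qed
qed

lemma conn_nsphere: "conn (nsphere n) = ereal (real n - 1)"
proof -
  have "(SUP k\<in>{k. k < int n}. ereal (real_of_int k)) = ereal (real n - 1)"
  proof (rule antisym)
    show "(SUP k\<in>{k. k < int n}. ereal (real_of_int k)) \<le> ereal (real n - 1)"
      by (intro SUP_least) simp
    have "ereal (real_of_int (int n - 1)) \<le> (SUP k\<in>{k. k < int n}. ereal (real_of_int k))"
      by (intro SUP_upper) simp
    then show "ereal (real n - 1) \<le> (SUP k\<in>{k. k < int n}. ereal (real_of_int k))"
      by simp
  qed
  then show ?thesis
    by (simp add: conn_def k_connected_nsphere)
qed

lemma neighborhood_complex_subset: "neighborhood_complex G \<subseteq> Pow (pverts G)"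
  by (auto simp: neighborhood_complex_def)

lemma neighborhood_complex_down:
  "A \<in> neighborhood_complex G \<Longrightarrow> B \<subseteq> A \<Longrightarrow> B \<in> neighborhood_complex G"
  by (fastforce simp: neighborhood_complex_def common_neighbors_def)

lemma graph_hom_neighborhood_complex:
  assumes "graph_hom G H \<phi>" "A \<in> neighborhood_complex G"
  shows "\<phi> ` A \<in> neighborhood_complex H"
proof -
  obtain x where x: "x \<in> common_neighbors G A" and A: "A \<subseteq> pverts G"
    using assms(2) by (auto simp: neighborhood_complex_def)
  have "\<phi> x \<in> common_neighbors H (\<phi> ` A)"
    using assms(1) x by (auto simp: graph_hom_def common_neighbors_def)
  moreover have "\<phi> ` A \<subseteq> pverts H"
    using assms(1) A by (auto simp: graph_hom_def)
  ultimately show ?thesis by (auto simp: neighborhood_complex_def)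
qed

lemma neighborhood_complex_complete_graph:
  "neighborhood_complex (complete_graph (n + 2)) = simplex_boundary n"
proof -
  have "common_neighbors (complete_graph (n + 2)) A = {1..n + 2} - A"
    if "A \<subseteq> {1..n + 2}" for A
    using that by (auto simp: common_neighbors_def complete_graph_def)
  then show ?thesis
    unfolding neighborhood_complex_def simplex_boundary_def
    by (auto simp: complete_graph_def)
qed

text \<open>
  The exponential graph folds onto its constant maps. A common neighbour of a set \<open>A\<close> of maps stays
  a common neighbour when the constant maps assigned to \<open>A\<close> are added, which is contiguity.
\<close>

lemma neighborhood_complex_exp_graph_complete:
  assumes T: "pair_graph T" "Digraph_Component.connected (with_proj T)" "property_P T"
      "m < chromatic_number T"
  shows "geometric_realization (neighborhood_complex (exp_graph (complete_graph m) T))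
           homotopy_equivalent_space geometric_realization (neighborhood_complex (complete_graph m))"
proof -
  interpret pair_graph T by fact
  let ?E = "exp_graph (complete_graph m) T"
  note hom = mono_colour_hom[OF T] const_colouring_hom[OF T(1), of m]
  show ?thesis
  proof (rule homotopy_equivalent_contiguous_retract)
    show "finite (pverts ?E)" "finite (pverts (complete_graph m))"
      using pair_finite_verts by (auto simp: exp_graph_def complete_graph_def intro!: finite_PiE)
    show "mono_colour T ` pverts ?E \<subseteq> pverts (complete_graph m)"
      "const_colouring T ` pverts (complete_graph m) \<subseteq> pverts ?E"
      using hom by (auto simp: graph_hom_def)
    show "mono_colour T (const_colouring T i) = i" if "i \<in> pverts (complete_graph m)" for i
      using that mono_colour_const[OF T(1,4)] by (simp add: complete_graph_def)
    show "const_colouring T ` mono_colour T ` A \<union> A \<in> neighborhood_complex ?E"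
      if A: "A \<in> neighborhood_complex ?E" for A
    proof -
      obtain g where g: "g \<in> common_neighbors ?E A"
        using A by (auto simp: neighborhood_complex_def)
      then have "g \<in> common_neighbors ?E (const_colouring T ` mono_colour T ` A \<union> A)"
        using neighbour_of_const_mono_colour[OF T] by (auto simp: common_neighbors_def)
      moreover have "const_colouring T ` mono_colour T ` A \<in> neighborhood_complex ?E"
        using A by (intro graph_hom_neighborhood_complex[OF hom(2)] graph_hom_neighborhood_complex[OF hom(1)])
      ultimately show ?thesis
        using A by (auto simp: neighborhood_complex_def)
    qed
  qed (use neighborhood_complex_subset neighborhood_complex_down
      graph_hom_neighborhood_complex[OF hom(1)] graph_hom_neighborhood_complex[OF hom(2)] in blast)+
qed

text \<open>
  The retraction onto \<open>K\<^sub>m\<close> determines the homotopy type, from which the connectivity \<open>m - 3\<close> is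
  read off; the chromatic number comes from the same retraction.
\<close>

theorem theorem1p2:
  fixes T :: "'a pair_pre_digraph" and m :: nat
  assumes "pair_graph T"
    and "Digraph_Component.connected (with_proj T)"
    and "property_P T"
    and "2 \<le> m" and "m < chromatic_number T"
  shows "ereal (real (chromatic_number (exp_graph (complete_graph m) T))) =
           conn (geometric_realization (neighborhood_complex (exp_graph (complete_graph m) T))) + 3 \<and>
         geometric_realization (neighborhood_complex (exp_graph (complete_graph m) T))
           homotopy_equivalent_space nsphere (m - 2)"
proof -
  have "m - 2 + 2 = m" using assms(4) by simp
  then have "neighborhood_complex (complete_graph m) = simplex_boundary (m - 2)"
    using neighborhood_complex_complete_graph[of "m - 2"] by simp
  then have "geometric_realization (neighborhood_complex (complete_graph m))
      homotopy_equivalent_space nsphere (m - 2)"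
    using simplex_boundary_homeomorphic_sphere[of "m - 2"]
    by (simp only: homeomorphic_imp_homotopy_equivalent_space)
  with neighborhood_complex_exp_graph_complete[OF assms(1-3,5)]
  have equiv: "geometric_realization (neighborhood_complex (exp_graph (complete_graph m) T))
      homotopy_equivalent_space nsphere (m - 2)"
    by (rule homotopy_eqv_trans)
  have "conn (geometric_realization (neighborhood_complex (exp_graph (complete_graph m) T))) + 3
      = ereal (real (m - 2) - 1) + ereal 3"
    unfolding conn_homotopy_equivalent[OF equiv] conn_nsphere by simp
  also have "\<dots> = ereal (real m)"
    using assms(4) by simp
  finally show ?thesis
    using equiv chromatic_number_exp_graph[OF assms(1-3,5)] by simp
qed

end
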